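(* Let $p$ be a prime and let $G$ be a finite abelian $p$-group with $|G|>2$. Let $\Gamma$ be the maximal $\mathbb{Z}$-order in $\mathbb{Q}[G]$, and put $J=|G|\Gamma$, $I=J\cap p\mathbb{Z}[G]$ (ideals of $\mathbb{Z}[G]$) and $\widetilde{G}=\sum_{g\in G}g$. Then there is an isomorphism of groups $$K_2(\mathbb{Z}[G]/I,(\widetilde{G}))\cong K_2(\mathbb{F}_p[G],(\widetilde{G})).$$
   Context: The inclusions $|G|\Gamma\subseteq\mathbb{Z}[G]\subseteq\Gamma$ hold, so $J$ is an ideal of $\mathbb{Z}[G]$. In each ring, $(\widetilde{G})$ denotes the ideal generated by the image of $\widetilde{G}$; since $J=I+\mathbb{Z}\widetilde{G}$, the ideal $(\widetilde{G})$ of $\mathbb{Z}[G]/I$ is $J/I$. For a commutative ring $R$ and a radical ideal $\mathfrak{a}$ of $R$ (an ideal contained in the Jacobson radical, e.g. one with $\mathfrak{a}^2=0$), the relative group $K_2(R,\mathfrak{a})$ is the abelian group generated by the Dennis–Stein symbols $\langle a,b\rangle$ with $(a,b)\in(R\times\mathfrak{a})\cup(\mathfrak{a}\times R)$, subject to the relations (written multiplicatively, whenever all the symbols involved are defined): (DS1) $\langle a,b\rangle\langle b,a\rangle=1$; (DS2) $\langle a,b\rangle\langle a,c\rangle=\langle a,b+c-abc\rangle$; (DS3) $\langle a,bc\rangle=\langle ab,c\rangle\langle ac,b\rangle$ where at least one of $a,b,c$ lies in $\mathfrak{a}$. In both rings of the statement the ideal $(\widetilde{G})$ has square zero. *)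

theory Defs
  imports "HOL-Algebra.Algebra" "HOL-Algebra.Algebraic_Closure_Type" "HOL-Number_Theory.Residues"
begin

section \<open>Group rings of finite groups\<close>

text \<open>
  Elements of \<open>R[G]\<close> are coefficient functions on \<^term>\<open>carrier G\<close>, and multiplication is
  convolution. The sum over \<^term>\<open>carrier G\<close> in the product is meaningful because only finite
  \<open>G\<close> are considered, so no support condition is imposed.
\<close>

definition group_ring ::
    "('r, 'a) ring_scheme \<Rightarrow> ('g, 'b) monoid_scheme \<Rightarrow> ('r, 'g \<Rightarrow> 'r) module"
  where "group_ring R G =
    \<lparr>carrier = carrier G \<rightarrow>\<^sub>E carrier R,
     monoid.mult = (\<lambda>f h. \<lambda>g\<in>carrier G. \<Oplus>\<^bsub>R\<^esub>x\<in>carrier G. f x \<otimes>\<^bsub>R\<^esub> h (inv\<^bsub>G\<^esub> x \<otimes>\<^bsub>G\<^esub> g)),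
     monoid.one = (\<lambda>g\<in>carrier G. if g = \<one>\<^bsub>G\<^esub> then \<one>\<^bsub>R\<^esub> else \<zero>\<^bsub>R\<^esub>),
     ring.zero = (\<lambda>g\<in>carrier G. \<zero>\<^bsub>R\<^esub>),
     ring.add = (\<lambda>f h. \<lambda>g\<in>carrier G. f g \<oplus>\<^bsub>R\<^esub> h g),
     module.smult = (\<lambda>r f. \<lambda>g\<in>carrier G. r \<otimes>\<^bsub>R\<^esub> f g)\<rparr>"

definition group_ring_of ::
    "('r, 'a) ring_scheme \<Rightarrow> ('g, 'b) monoid_scheme \<Rightarrow> 'g \<Rightarrow> 'g \<Rightarrow> 'r"
  where "group_ring_of R G g = (\<lambda>h\<in>carrier G. if h = g then \<one>\<^bsub>R\<^esub> else \<zero>\<^bsub>R\<^esub>)"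

text \<open>The element \<open>\<Sum>\<^sub>g g\<close> of \<open>R[G]\<close>, written \<open>G\<close> with a tilde in the literature.\<close>

definition group_sum :: "('r, 'a) ring_scheme \<Rightarrow> ('g, 'b) monoid_scheme \<Rightarrow> 'g \<Rightarrow> 'r"
  where "group_sum R G = (\<Oplus>\<^bsub>group_ring R G\<^esub>g\<in>carrier G. group_ring_of R G g)"

text \<open>
  The integers are taken as the subring \<^term>\<open>\<int>\<close> of the rationals, so that \<open>\<int>[G]\<close> is literally
  a subring of \<open>\<rat>[G]\<close> and can be compared there with orders of \<open>\<rat>[G]\<close>.
\<close>

definition rat_field :: "rat ring"
  where "rat_field = ring_of_type_algebra"

definition int_subring :: "rat ring"
  where "int_subring = rat_field\<lparr>carrier := \<int>\<rparr>"


section \<open>Maximal orders\<close>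

text \<open>The last conjunct of the definition says \<open>\<rat> L = A\<close>.\<close>

definition Z_order :: "(rat, 'a, 'b) module_scheme \<Rightarrow> 'a set \<Rightarrow> bool"
  where "Z_order A L \<longleftrightarrow>
    subring L A \<and>
    (\<exists>S. finite S \<and> S \<subseteq> carrier A \<and> L = generate (add_monoid A) S) \<and>
    generate (add_monoid A) {q \<odot>\<^bsub>A\<^esub> x | q x. x \<in> L} = carrier A"

definition maximal_Z_order :: "(rat, 'a, 'b) module_scheme \<Rightarrow> 'a set \<Rightarrow> bool"
  where "maximal_Z_order A L \<longleftrightarrow>
    Z_order A L \<and> (\<forall>L'. Z_order A L' \<and> L \<subseteq> L' \<longrightarrow> L' = L)"


section \<open>The relative group \<open>K\<^sub>2(R, \<aa>)\<close>\<close>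

text \<open>
  The presentation by Dennis--Stein symbols, intended for a commutative ring \<open>R\<close> and an ideal
  \<open>\<aa>\<close> contained in its Jacobson radical. The free abelian group of the library is written
  additively, so a relation \<open>u v = w\<close> becomes the relator \<open>u + v - w\<close>.
\<close>

definition DS_symbols :: "('r, 'a) ring_scheme \<Rightarrow> 'r set \<Rightarrow> ('r \<times> 'r) set"
  where "DS_symbols R \<aa> = carrier R \<times> \<aa> \<union> \<aa> \<times> carrier R"

definition DS_relators :: "('r, 'a) ring_scheme \<Rightarrow> 'r set \<Rightarrow> ('r \<times> 'r \<Rightarrow>\<^sub>0 int) set"
  where "DS_relators R \<aa> =
    {frag_of (a, b) + frag_of (b, a) | a b. (a, b) \<in> DS_symbols R \<aa>} \<union>
    {frag_of (a, b) + frag_of (a, c)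
       - frag_of (a, b \<oplus>\<^bsub>R\<^esub> c \<ominus>\<^bsub>R\<^esub> a \<otimes>\<^bsub>R\<^esub> b \<otimes>\<^bsub>R\<^esub> c) | a b c.
       (a, b) \<in> DS_symbols R \<aa> \<and> (a, c) \<in> DS_symbols R \<aa> \<and>
       (a, b \<oplus>\<^bsub>R\<^esub> c \<ominus>\<^bsub>R\<^esub> a \<otimes>\<^bsub>R\<^esub> b \<otimes>\<^bsub>R\<^esub> c) \<in> DS_symbols R \<aa>} \<union>
    {frag_of (a, b \<otimes>\<^bsub>R\<^esub> c) - (frag_of (a \<otimes>\<^bsub>R\<^esub> b, c) + frag_of (a \<otimes>\<^bsub>R\<^esub> c, b)) | a b c.
       a \<in> carrier R \<and> b \<in> carrier R \<and> c \<in> carrier R \<and> (a \<in> \<aa> \<or> b \<in> \<aa> \<or> c \<in> \<aa>)}"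

definition K2_rel :: "('r, 'a) ring_scheme \<Rightarrow> 'r set \<Rightarrow> ('r \<times> 'r \<Rightarrow>\<^sub>0 int) set monoid"
  where "K2_rel R \<aa> =
    free_Abelian_group (DS_symbols R \<aa>) Mod
      generate (free_Abelian_group (DS_symbols R \<aa>)) (DS_relators R \<aa>)"

end

theory Submission
  imports Defs
begin

text \<open>
  Write \<open>R = \<int>[G]/I\<close> and \<open>S = \<F>\<^sub>p[G]\<close>, and let \<open>t\<close> be the image of \<open>N = \<Sum>g\<close> in either ring.
  Since \<open>f N\<close> is the sum of the coefficients of \<open>f\<close>, times \<open>N\<close>, both ideals \<open>(t)\<close> are additively generated by \<open>t\<close>.
  Because \<open>I \<subseteq> p\<int>[G]\<close>, reduction modulo \<open>p\<close> is a surjection \<open>R \<rightarrow> S\<close>, with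
  kernel contained in \<open>pR\<close>. The maximal order contains the idempotent \<open>N/|G|\<close>, so
  \<open>pN = |G| (p N/|G|)\<close> lies in \<open>I\<close>; hence \<open>pt = 0\<close> in \<open>R\<close>, and \<open>(t)\<close> has order \<open>p\<close> in both
  rings and is mapped isomorphically from one to the other.

  Generators and relators of the second presentation are therefore exactly the images of those of
  the first, and the two groups agree as soon as symbols with equal images are already equal in
  \<open>K\<^sub>2(R,(t))\<close> (\<open>free_Abelian_presentation_iso\<close>). This comes down to
  \<open>\<langle>t, x + py\<rangle> = \<langle>t, x\<rangle>\<close>. Put \<open>D(x) = \<langle>t, x\<rangle>\<close>, written additively, and let \<open>n\<^sub>x\<close> be the scalar by
  which \<open>x\<close> acts on \<open>t\<close>. The relations give \<open>p D(x) = 0\<close> and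
  \<open>D(b + c) = D(b) + D(c) + n\<^sub>b n\<^sub>c D(t)\<close> (\<open>D_add\<close>), whence by induction
  \<open>D(my) = m D(y) + (m choose 2) n\<^sub>y\<^sup>2 D(t)\<close> (\<open>D_multiple\<close>).
  For odd \<open>p\<close> this vanishes at \<open>m = p\<close>, because \<open>p\<close> divides \<open>p choose 2\<close>. For \<open>p = 2\<close> the obstruction is
  \<open>D(t)\<close>, and this is where \<open>|G| > 2\<close> enters: with \<open>s\<close> of order two and \<open>T\<close> a transversal of
  \<open>{1, s}\<close> one has \<open>N = (1 + s) (\<Sum>T)\<close>, and since \<open>4\<close> divides \<open>|G|\<close> both factors
  annihilate \<open>t\<close>, so that the third relation gives \<open>D(t) = 0\<close>.
\<close>

section \<open>Comparing presentations of abelian groups\<close>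

lemma keys_frag_extend_of_subset:
  assumes "f ` A \<subseteq> B" "Poly_Mapping.keys c \<subseteq> A"
  shows "Poly_Mapping.keys (frag_extend (frag_of \<circ> f) c) \<subseteq> B"
  using keys_frag_extend[of "frag_of \<circ> f" c] assms by fastforce

lemma free_Abelian_group_subgroup_closed:
  assumes "subgroup N (free_Abelian_group A)"
  shows "0 \<in> N"
    and "x \<in> N \<Longrightarrow> y \<in> N \<Longrightarrow> x + y \<in> N"
    and "x \<in> N \<Longrightarrow> - x \<in> N"
    and "x \<in> N \<Longrightarrow> y \<in> N \<Longrightarrow> x - y \<in> N"
proof -
  show add: "x + y \<in> N" if "x \<in> N" "y \<in> N" for x y
    using subgroup.m_closed[OF assms that] by simp
  show minus: "- x \<in> N" if "x \<in> N" for x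
    using subgroup.m_inv_closed[OF assms that] subgroup.subset[OF assms] that
    by (metis carrier_free_Abelian_group_iff inv_free_Abelian_group subsetD)
  show "x - y \<in> N" if "x \<in> N" "y \<in> N"
    using add[OF that(1) minus[OF that(2)]] by simp
  show "0 \<in> N"
    using subgroup.one_closed[OF assms] by simp
qed

text \<open>
  If a surjection \<open>f\<close> of generators carries the relators onto the relators, the induced map on the
  presented groups is onto, and its kernel is generated by the differences of generators with the same
  image. So it is an isomorphism once these differences are consequences of the relators.
\<close>

lemma free_Abelian_presentation_iso:
  fixes f :: "'x \<Rightarrow> 'y"
  assumes fA: "f ` A = B"
    and RA: "RA \<subseteq> carrier (free_Abelian_group A)"
    and RB: "frag_extend (frag_of \<circ> f) ` RA = RB"
    and fibre: "\<And>x x'. \<lbrakk>x \<in> A; x' \<in> A; f x = f x'\<rbrakk> \<Longrightarrow>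
      frag_of x - frag_of x' \<in> generate (free_Abelian_group A) RA"
  shows "free_Abelian_group A Mod generate (free_Abelian_group A) RA
       \<cong> free_Abelian_group B Mod generate (free_Abelian_group B) RB"
proof -
  let ?F = "free_Abelian_group A" and ?H = "free_Abelian_group B"
  let ?NA = "generate ?F RA" and ?NB = "generate ?H RB"
  let ?\<phi> = "frag_extend (frag_of \<circ> f)"
  interpret F: comm_group ?F by (rule abelian_free_Abelian_group)
  interpret H: comm_group ?H by (rule abelian_free_Abelian_group)
  have subA: "subgroup ?NA ?F"
    by (rule F.generate_is_subgroup[OF RA])
  have \<phi>_carrier: "?\<phi> c \<in> carrier ?H" if "c \<in> carrier ?F" for c
    using that fA keys_frag_extend_of_subset[of f A B c] by simp
  have \<phi>: "?\<phi> \<in> hom ?F ?H"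
    using \<phi>_carrier by (intro homI) (auto simp: frag_extend_add)
  interpret \<phi>: group_hom ?F ?H ?\<phi>
    by unfold_locales (rule \<phi>)
  have RBc: "RB \<subseteq> carrier ?H"
    using RA RB \<phi>_carrier by blast
  have subB: "subgroup ?NB ?H"
    by (rule H.generate_is_subgroup[OF RBc])
  have imgN: "?\<phi> ` ?NA = ?NB"
    using \<phi>.generate_img[OF RA] RB by simp
  \<comment> \<open>A section of \<open>f\<close> recovers every chain from its image, up to relators.\<close>
  define \<sigma> where "\<sigma> = inv_into A f"
  have \<sigma>A: "\<sigma> y \<in> A" and f\<sigma>: "f (\<sigma> y) = y" if "y \<in> B" for y
    using that fA by (auto simp: \<sigma>_def inv_into_into f_inv_into_f)
  have sect: "c - frag_extend (frag_of \<circ> \<sigma>) (?\<phi> c) \<in> ?NA" if "c \<in> carrier ?F" for c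
  proof -
    have "Poly_Mapping.keys c \<subseteq> A" using that by simp
    then show ?thesis
    proof (induction c rule: frag_induction)
      case zero
      show ?case using free_Abelian_group_subgroup_closed(1)[OF subA] by simp
    next
      case (one x)
      have "\<sigma> (f x) \<in> A" "f (\<sigma> (f x)) = f x"
        using one fA \<sigma>A f\<sigma> by blast+
      then show ?case
        using fibre[of x "\<sigma> (f x)"] one by simp
    next
      case (diff a b)
      show ?case
        using free_Abelian_group_subgroup_closed(4)[OF subA diff]
        by (simp add: frag_extend_diff algebra_simps)
    qed
  qed
  have \<phi>_surj: "?\<phi> ` carrier ?F = carrier ?H"
  proof
    show "?\<phi> ` carrier ?F \<subseteq> carrier ?H" using \<phi>_carrier by blast
    show "carrier ?H \<subseteq> ?\<phi> ` carrier ?F"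
    proof
      fix d assume d: "d \<in> carrier ?H"
      let ?c = "frag_extend (frag_of \<circ> \<sigma>) d"
      have "?c \<in> carrier ?F"
        using keys_frag_extend_of_subset[of \<sigma> B A d] d \<sigma>A by auto
      moreover have "?\<phi> ?c = d"
      proof -
        have "?\<phi> ?c = frag_extend ((frag_of \<circ> f) \<circ> \<sigma>) d"
          by (rule frag_extend_compose)
        also have "\<dots> = frag_extend frag_of d"
          by (rule frag_extend_eq) (use d f\<sigma> in auto)
        finally show ?thesis using frag_expansion[of d] by simp
      qed
      ultimately show "d \<in> ?\<phi> ` carrier ?F" by (metis imageI)
    qed
  qed
  have nB: "?NB \<lhd> ?H"
    using H.subgroup_imp_normal[OF subB] .
  have grpB: "group (?H Mod ?NB)"
    by (rule normal.factorgroup_is_group[OF nB])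
  let ?q = "\<lambda>c. ?NB #>\<^bsub>?H\<^esub> ?\<phi> c"
  have qhom: "?q \<in> hom ?F (?H Mod ?NB)"
    using hom_compose[OF \<phi> normal.r_coset_hom_Mod[OF nB]] by (simp add: comp_def)
  interpret q: group_hom ?F "?H Mod ?NB" ?q
    by (intro group_hom.intro group_hom_axioms.intro F.is_group grpB qhom)
  have qsurj: "?q ` carrier ?F = carrier (?H Mod ?NB)"
    unfolding carrier_FactGroup \<phi>_surj[symmetric] image_image by (rule refl)
  have ker: "kernel ?F (?H Mod ?NB) ?q = ?NA"
  proof
    show "?NA \<subseteq> kernel ?F (?H Mod ?NB) ?q"
    proof
      fix c assume c: "c \<in> ?NA"
      then have "c \<in> carrier ?F" using subgroup.subset[OF subA] by blast
      moreover have "?q c = ?NB"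
        by (rule subgroup.rcos_const[OF subB H.is_group]) (use c imgN in blast)
      ultimately show "c \<in> kernel ?F (?H Mod ?NB) ?q"
        by (simp add: kernel_def FactGroup_def)
    qed
    show "kernel ?F (?H Mod ?NB) ?q \<subseteq> ?NA"
    proof
      fix c assume "c \<in> kernel ?F (?H Mod ?NB) ?q"
      then have c: "c \<in> carrier ?F" and "?q c = ?NB"
        by (auto simp: kernel_def FactGroup_def)
      then have "?\<phi> c \<in> ?NB"
        using H.coset_join1[OF _ \<phi>_carrier[OF c] subB] by simp
      then obtain d where d: "d \<in> ?NA" "?\<phi> c = ?\<phi> d"
        using imgN by (metis imageE)
      have "d \<in> carrier ?F" using d subgroup.subset[OF subA] by blast
      note sc = sect[OF c] and sd = sect[OF this]
      have "c = (c - frag_extend (frag_of \<circ> \<sigma>) (?\<phi> c))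
              - (d - frag_extend (frag_of \<circ> \<sigma>) (?\<phi> d)) + d"
        using d(2) by simp
      then show "c \<in> ?NA"
        using free_Abelian_group_subgroup_closed[OF subA] sc sd d(1) by metis
    qed
  qed
  have "?F Mod kernel ?F (?H Mod ?NB) ?q \<cong> ?H Mod ?NB"
    by (rule q.FactGroup_iso[OF qsurj])
  then show ?thesis unfolding ker .
qed

section \<open>Symbols along a line of scalars\<close>

text \<open>
  The hypotheses make the ideal \<open>(t)\<close> the additive group generated by \<open>t\<close>, with \<open>R\<close> acting on it
  through scalars and with square zero; for a group ring, the scalars are given by the augmentation. Scalars are
  natural numbers, which loses nothing since they only matter modulo \<open>p\<close>, and which permits
  induction on them.
\<close>

locale scalar_line = cring R for R (structure) +
  fixes t :: 'a and p :: nat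
  assumes t_closed [simp, intro]: "t \<in> carrier R"
    and scalar: "r \<in> carrier R \<Longrightarrow> \<exists>n::nat. r \<otimes> t = add_pow R n t"
    and t_square: "t \<otimes> t = \<zero>"
    and p_torsion: "add_pow R p t = \<zero>"
begin

abbreviation nat_multiple :: "nat \<Rightarrow> 'a \<Rightarrow> 'a" (infixr "\<bullet>" 75)
  where "m \<bullet> x \<equiv> add_pow R m x"

abbreviation \<aa> :: "'a set" where "\<aa> \<equiv> Idl {t}"

abbreviation chains :: "('a \<times> 'a \<Rightarrow>\<^sub>0 int) monoid"
  where "chains \<equiv> free_Abelian_group (DS_symbols R \<aa>)"

abbreviation null_chains :: "('a \<times> 'a \<Rightarrow>\<^sub>0 int) set"
  where "null_chains \<equiv> generate chains (DS_relators R \<aa>)"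

text \<open>
  Equality in \<open>K\<^sub>2(R, (t))\<close>, tested on formal sums of symbols. Working with representatives
  keeps the calculations in the additive notation of a type class instead of cosets.
\<close>

definition K2_eq :: "('a \<times> 'a \<Rightarrow>\<^sub>0 int) \<Rightarrow> ('a \<times> 'a \<Rightarrow>\<^sub>0 int) \<Rightarrow> bool" (infix "\<approx>\<^sub>2" 50)
  where "x \<approx>\<^sub>2 y \<longleftrightarrow> x - y \<in> null_chains"

lemma add_pow_mult: "x \<in> carrier R \<Longrightarrow> (m * k) \<bullet> x = k \<bullet> (m \<bullet> x)"
  using add.nat_pow_pow[of x k m] by (simp add: mult.commute)

lemma add_pow_Suc: "(Suc m) \<bullet> x = m \<bullet> x \<oplus> x"
  by (simp add: add_pow_def nat_pow_def)

lemma add_pow_0: "0 \<bullet> x = \<zero>"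
  by (simp add: add_pow_def nat_pow_def)

lemma line_closed [simp, intro]: "m \<bullet> t \<in> carrier R"
  using add.nat_pow_closed by blast

lemma mult_line:
  assumes "r \<in> carrier R" "r \<otimes> t = n \<bullet> t"
  shows "r \<otimes> m \<bullet> t = (n * m) \<bullet> t"
  using assms add_pow_rdistr[OF assms(1) t_closed, of m] add_pow_mult[of t n m] by simp

lemma line_times_line: "(m \<bullet> t) \<otimes> (k \<bullet> t) = \<zero>"
  using add_pow_ldistr[OF t_closed line_closed, of m k] add_pow_rdistr[OF t_closed t_closed, of k] t_square by simp

lemma ideal_eq_line: "\<aa> = {m \<bullet> t | m :: nat. True}"
proof -
  have "\<aa> = {x \<otimes> t | x. x \<in> carrier R}"
    using cgenideal_eq_genideal[OF t_closed] by (simp add: cgenideal_def)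
  also have "\<dots> = {m \<bullet> t | m :: nat. True}"
  proof (intro equalityI subsetI)
    fix y assume "y \<in> {x \<otimes> t | x. x \<in> carrier R}"
    then show "y \<in> {m \<bullet> t | m :: nat. True}" using scalar by blast
  next
    fix y assume "y \<in> {m \<bullet> t | m :: nat. True}"
    then obtain m :: nat where m: "y = m \<bullet> t" by blast
    have "y = (m \<bullet> \<one>) \<otimes> t"
      using add_pow_ldistr[OF one_closed t_closed, of m] m by simp
    then show "y \<in> {x \<otimes> t | x. x \<in> carrier R}" by auto
  qed
  finally show ?thesis .
qed

lemma line_in_ideal [simp, intro]: "m \<bullet> t \<in> \<aa>"
  by (auto simp: ideal_eq_line)

lemma t_in_ideal [simp, intro]: "t \<in> \<aa>"
  using genideal_self' by simp

lemma ideal_aa: "ideal \<aa> R"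
  using genideal_ideal by simp

lemma zero_in_ideal [simp, intro]: "\<zero> \<in> \<aa>"
  using additive_subgroup.zero_closed[OF ideal.axioms(1)[OF ideal_aa]] .

lemma ideal_in_carrier: "x \<in> \<aa> \<Longrightarrow> x \<in> carrier R"
  using additive_subgroup.a_Hcarr[OF ideal.axioms(1)[OF ideal_aa]] .

lemma DS_relators_closed: "DS_relators R \<aa> \<subseteq> carrier chains"
proof -
  have 1: "(b, a) \<in> DS_symbols R \<aa>" if "(a, b) \<in> DS_symbols R \<aa>" for a b
    using that by (auto simp: DS_symbols_def)
  have 2: "(a, b \<otimes> c) \<in> DS_symbols R \<aa> \<and> (a \<otimes> b, c) \<in> DS_symbols R \<aa> \<and> (a \<otimes> c, b) \<in> DS_symbols R \<aa>"
    if "a \<in> carrier R" "b \<in> carrier R" "c \<in> carrier R" "a \<in> \<aa> \<or> b \<in> \<aa> \<or> c \<in> \<aa>" for a b c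
    using that ideal.I_l_closed[OF ideal_aa] ideal.I_r_closed[OF ideal_aa]
    by (auto simp: DS_symbols_def)
  interpret C: comm_group chains by (rule abelian_free_Abelian_group)
  note closed = free_Abelian_group_subgroup_closed[OF C.subgroup_self]
  have frag: "frag_of s \<in> carrier chains" if "s \<in> DS_symbols R \<aa>" for s
    using that by simp
  show ?thesis
    unfolding DS_relators_def using 1 2
    by (auto intro!: closed(2,4) frag simp del: carrier_free_Abelian_group_iff)
qed

lemma null_subgroup: "subgroup null_chains chains"
  by (rule group.generate_is_subgroup[OF group_free_Abelian_group DS_relators_closed])

lemmas null_closed = free_Abelian_group_subgroup_closed[OF null_subgroup]

lemma K2_eq_refl [simp, intro]: "x \<approx>\<^sub>2 x"
  using null_closed(1) by (simp add: K2_eq_def)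

lemma K2_eq_sym: "x \<approx>\<^sub>2 y \<Longrightarrow> y \<approx>\<^sub>2 x"
  using null_closed(3)[of "x - y"] by (simp add: K2_eq_def)

lemma K2_eq_trans [trans]: "x \<approx>\<^sub>2 y \<Longrightarrow> y \<approx>\<^sub>2 z \<Longrightarrow> x \<approx>\<^sub>2 z"
  using null_closed(2)[of "x - y" "y - z"] by (simp add: K2_eq_def)

lemma K2_eq_add: "x \<approx>\<^sub>2 x' \<Longrightarrow> y \<approx>\<^sub>2 y' \<Longrightarrow> x + y \<approx>\<^sub>2 x' + y'"
  using null_closed(2)[of "x - x'" "y - y'"] by (simp add: K2_eq_def algebra_simps)

lemma K2_eq_minus: "x \<approx>\<^sub>2 y \<Longrightarrow> - x \<approx>\<^sub>2 - y"
  using null_closed(3)[of "x - y"] by (simp add: K2_eq_def)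

lemma frag_cmul_Suc: "frag_cmul (int (Suc m)) x = frag_cmul (int m) x + x"
  using frag_cmul_distrib[of "int m" 1 x] by (simp add: add.commute)

lemma K2_eq_cmul: "x \<approx>\<^sub>2 y \<Longrightarrow> frag_cmul (int m) x \<approx>\<^sub>2 frag_cmul (int m) y"
  by (induction m) (auto simp only: frag_cmul_Suc intro: K2_eq_add, simp)

lemma DS1: "(a, b) \<in> DS_symbols R \<aa> \<Longrightarrow> frag_of (a, b) \<approx>\<^sub>2 - frag_of (b, a)"
  unfolding K2_eq_def by (auto intro!: generate.incl simp: DS_relators_def)

lemma DS2:
  assumes "(a, b) \<in> DS_symbols R \<aa>" "(a, c) \<in> DS_symbols R \<aa>"
    "(a, b \<oplus> c \<ominus> a \<otimes> b \<otimes> c) \<in> DS_symbols R \<aa>"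
  shows "frag_of (a, b) + frag_of (a, c) \<approx>\<^sub>2 frag_of (a, b \<oplus> c \<ominus> a \<otimes> b \<otimes> c)"
  unfolding K2_eq_def using assms by (auto intro!: generate.incl simp: DS_relators_def)

lemma DS3:
  assumes "a \<in> carrier R" "b \<in> carrier R" "c \<in> carrier R" "a \<in> \<aa> \<or> b \<in> \<aa> \<or> c \<in> \<aa>"
  shows "frag_of (a, b \<otimes> c) \<approx>\<^sub>2 frag_of (a \<otimes> b, c) + frag_of (a \<otimes> c, b)"
  unfolding K2_eq_def
  by (rule generate.incl) (use assms in \<open>unfold DS_relators_def, blast\<close>)

lemma symbol_zero_right:
  assumes "r \<in> carrier R"
  shows "frag_of (r, \<zero>) \<approx>\<^sub>2 0"
proof -
  have "frag_of (r, \<zero>) + frag_of (r, \<zero>) \<approx>\<^sub>2 frag_of (r, \<zero> \<oplus> \<zero> \<ominus> r \<otimes> \<zero> \<otimes> \<zero>)"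
    using assms by (intro DS2) (auto simp: DS_symbols_def a_minus_def)
  moreover have "\<zero> \<oplus> \<zero> \<ominus> r \<otimes> \<zero> \<otimes> \<zero> = \<zero>"
    using assms by (simp add: a_minus_def)
  ultimately show ?thesis by (simp add: K2_eq_def)
qed

lemma symbol_zero_left:
  assumes "r \<in> carrier R"
  shows "frag_of (\<zero>, r) \<approx>\<^sub>2 0"
proof -
  have "frag_of (\<zero>, r) \<approx>\<^sub>2 - frag_of (r, \<zero>)"
    using assms by (intro DS1) (auto simp: DS_symbols_def)
  also have "- frag_of (r, \<zero>) \<approx>\<^sub>2 - 0"
    by (rule K2_eq_minus[OF symbol_zero_right[OF assms]])
  finally show ?thesis by simp
qed

text \<open>
  In the second relation the correction term \<open>abc\<close> vanishes when \<open>b\<close> and \<open>c\<close> both lie on the line,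
  since its square is zero; so a symbol is additive along the line.
\<close>

lemma symbol_line:
  assumes r: "r \<in> carrier R"
  shows "frag_of (r, m \<bullet> t) \<approx>\<^sub>2 frag_cmul (int m) (frag_of (r, t))"
proof (induction m)
  case 0
  then show ?case using symbol_zero_right[OF r] by (simp add: add_pow_0)
next
  case (Suc m)
  have "r \<otimes> m \<bullet> t \<otimes> t = r \<otimes> (m \<bullet> t \<otimes> 1 \<bullet> t)"
    using r by (simp add: m_assoc)
  also have "\<dots> = \<zero>"
    using r by (simp only: line_times_line r_null)
  finally have *: "r \<otimes> m \<bullet> t \<otimes> t = \<zero>" .
  then have eq: "m \<bullet> t \<oplus> t \<ominus> r \<otimes> m \<bullet> t \<otimes> t = (Suc m) \<bullet> t"
    using r by (simp add: * a_minus_def add_pow_Suc)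
  have "frag_of (r, m \<bullet> t) + frag_of (r, t) \<approx>\<^sub>2 frag_of (r, m \<bullet> t \<oplus> t \<ominus> r \<otimes> m \<bullet> t \<otimes> t)"
    by (rule DS2) (use r line_in_ideal in \<open>auto simp only: eq DS_symbols_def t_in_ideal\<close>)
  then have "frag_of (r, (Suc m) \<bullet> t) \<approx>\<^sub>2 frag_of (r, m \<bullet> t) + frag_of (r, t)"
    unfolding eq by (rule K2_eq_sym)
  also have "\<dots> \<approx>\<^sub>2 frag_cmul (int m) (frag_of (r, t)) + frag_of (r, t)"
    by (rule K2_eq_add[OF Suc K2_eq_refl])
  finally show ?case by (simp only: frag_cmul_Suc)
qed

text \<open>
  By the previous lemma and antisymmetry every symbol is a multiple of some
  \<open>\<langle>t, r\<rangle>\<close>, so the group is controlled by this one function of \<open>r\<close>.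
\<close>

definition D :: "'a \<Rightarrow> ('a \<times> 'a \<Rightarrow>\<^sub>0 int)"
  where "D r = frag_of (t, r)"

lemma symbol_line_eq_D:
  assumes r: "r \<in> carrier R"
  shows "frag_of (r, m \<bullet> t) \<approx>\<^sub>2 - frag_cmul (int m) (D r)"
proof -
  have "frag_of (r, m \<bullet> t) \<approx>\<^sub>2 frag_cmul (int m) (frag_of (r, t))"
    by (rule symbol_line[OF r])
  also have "\<dots> \<approx>\<^sub>2 frag_cmul (int m) (- D r)"
    unfolding D_def using r by (intro K2_eq_cmul DS1) (auto simp: DS_symbols_def)
  also have "frag_cmul (int m) (- D r) = - frag_cmul (int m) (D r)"
    by (simp add: poly_mapping_eqI)
  finally show ?thesis .
qed

lemma D_p_torsion:
  assumes r: "r \<in> carrier R"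
  shows "frag_cmul (int (p * k)) (D r) \<approx>\<^sub>2 0"
proof -
  have "(p * k) \<bullet> t = \<zero>"
    using add_pow_mult[of t p k] p_torsion by simp
  then have "- frag_cmul (int (p * k)) (D r) \<approx>\<^sub>2 frag_of (r, \<zero>)"
    using K2_eq_sym[OF symbol_line_eq_D[OF r, of "p * k"]] by simp
  also have "\<dots> \<approx>\<^sub>2 0" by (rule symbol_zero_right[OF r])
  finally show ?thesis using K2_eq_minus by fastforce
qed

text \<open>
  The second relation adds \<open>D(b)\<close> and \<open>D(c)\<close> to \<open>D(b + c - ijt)\<close>. Applying it again, to
  \<open>b + c - ijt\<close> and \<open>ijt\<close>, has no correction term, because \<open>t\<^sup>2 = 0\<close>; it moves \<open>ijt\<close> out
  at the price of \<open>ij D(t)\<close>.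
\<close>

lemma D_add:
  assumes b: "b \<in> carrier R" and c: "c \<in> carrier R"
    and bt: "b \<otimes> t = i \<bullet> t" and ct: "c \<otimes> t = j \<bullet> t"
  shows "D (b \<oplus> c) \<approx>\<^sub>2 D b + D c + frag_cmul (int (i * j)) (D t)"
proof -
  let ?k = "i * j"
  let ?y = "b \<oplus> c \<ominus> ?k \<bullet> t"
  have y: "?y \<in> carrier R" using b c by simp
  have "t \<otimes> b \<otimes> c = b \<otimes> (c \<otimes> t)"
    using b c by (simp add: m_ac)
  also have "\<dots> = ?k \<bullet> t"
    unfolding ct by (rule mult_line[OF b bt])
  finally have "b \<oplus> c \<ominus> t \<otimes> b \<otimes> c = ?y" by simp
  then have 1: "D b + D c \<approx>\<^sub>2 D ?y"
    using DS2[of t b c] b c y by (auto simp: D_def DS_symbols_def)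
  have "t \<otimes> ?y \<otimes> ?k \<bullet> t = ?y \<otimes> (1 \<bullet> t \<otimes> ?k \<bullet> t)"
    using y by (simp add: m_ac)
  also have "\<dots> = \<zero>"
    using y by (simp only: line_times_line r_null)
  finally have "?y \<oplus> ?k \<bullet> t \<ominus> t \<otimes> ?y \<otimes> ?k \<bullet> t = ?y \<oplus> ?k \<bullet> t"
    using y by (simp add: a_minus_def)
  also have "\<dots> = b \<oplus> c"
    using b c line_closed[of ?k] by algebra
  finally have e: "?y \<oplus> ?k \<bullet> t \<ominus> t \<otimes> ?y \<otimes> ?k \<bullet> t = b \<oplus> c" .
  have "D ?y + D (?k \<bullet> t) \<approx>\<^sub>2 D (b \<oplus> c)"
    using DS2[of t ?y "?k \<bullet> t"] y b c unfolding e by (auto simp: D_def DS_symbols_def)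
  then have "D (b \<oplus> c) \<approx>\<^sub>2 D ?y + D (?k \<bullet> t)" by (rule K2_eq_sym)
  also have "\<dots> \<approx>\<^sub>2 (D b + D c) + frag_cmul (int ?k) (D t)"
    by (rule K2_eq_add[OF K2_eq_sym[OF 1]]) (use symbol_line[of t ?k] in \<open>simp add: D_def\<close>)
  finally show ?thesis .
qed

lemma add_pow_times_t:
  assumes "y \<in> carrier R" "y \<otimes> t = n \<bullet> t"
  shows "(m \<bullet> y) \<otimes> t = (n * m) \<bullet> t"
  using assms add_pow_ldistr[OF assms(1) t_closed, of m] add_pow_mult[of t n m] by simp

text \<open>
  The quadratic defect of \<open>D\<close> accumulates: the \<open>m\<close>-th step of the induction contributes
  \<open>m n\<^sup>2 D(t)\<close>, and the contributions sum to a binomial coefficient.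
\<close>

lemma D_multiple:
  assumes y: "y \<in> carrier R" and yt: "y \<otimes> t = n \<bullet> t"
  shows "D (m \<bullet> y) \<approx>\<^sub>2 frag_cmul (int m) (D y) + frag_cmul (int ((m choose 2) * n * n)) (D t)"
proof (induction m)
  case 0
  then show ?case
    using symbol_zero_right[OF t_closed] by (simp add: D_def add_pow_0 binomial_eq_0)
next
  case (Suc m)
  have my: "m \<bullet> y \<in> carrier R" using y by simp
  have ch: "(Suc m choose 2) = m + (m choose 2)"
    by (simp add: numeral_2_eq_2)
  have "D ((Suc m) \<bullet> y) \<approx>\<^sub>2 D (m \<bullet> y) + D y + frag_cmul (int ((n * m) * n)) (D t)"
    unfolding add_pow_Suc by (rule D_add[OF my y add_pow_times_t[OF y yt] yt])
  also have "\<dots> \<approx>\<^sub>2 (frag_cmul (int m) (D y) + frag_cmul (int ((m choose 2) * n * n)) (D t))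
      + D y + frag_cmul (int ((n * m) * n)) (D t)"
    by (intro K2_eq_add Suc K2_eq_refl)
  also have "\<dots> = frag_cmul (int (Suc m)) (D y) + frag_cmul (int ((Suc m choose 2) * n * n)) (D t)"
  proof -
    have "int ((Suc m choose 2) * n * n) = int ((m choose 2) * n * n) + int ((n * m) * n)"
      unfolding ch by (simp add: algebra_simps)
    then show ?thesis
      by (simp only: frag_cmul_Suc frag_cmul_distrib ac_simps)
  qed
  finally show ?case .
qed

text \<open>
  The third relation writes \<open>\<langle>t, uv\<rangle>\<close> as \<open>\<langle>tu, v\<rangle> + \<langle>tv, u\<rangle>\<close>, a sum of two symbols
  with a zero entry.
\<close>

lemma D_t_zero_of_factorisation:
  assumes u: "u \<in> carrier R" "u \<otimes> t = \<zero>" and v: "v \<in> carrier R" "v \<otimes> t = \<zero>"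
    and t: "t = u \<otimes> v"
  shows "D t \<approx>\<^sub>2 0"
proof -
  have "frag_of (t, u \<otimes> v) \<approx>\<^sub>2 frag_of (t \<otimes> u, v) + frag_of (t \<otimes> v, u)"
    using u v by (intro DS3) auto
  also have "t \<otimes> u = \<zero>" "t \<otimes> v = \<zero>"
    using u v m_comm[OF t_closed] by auto
  then have "frag_of (t \<otimes> u, v) + frag_of (t \<otimes> v, u) \<approx>\<^sub>2 0 + 0"
    using K2_eq_add[OF symbol_zero_left[OF v(1)] symbol_zero_left[OF u(1)]] by simp
  finally show ?thesis by (simp add: D_def t[symmetric])
qed

end

text \<open>
  For \<open>p = 2\<close> the factorisation of \<open>t\<close> serves to kill \<open>D(t)\<close>, as \<open>2 choose 2\<close> is odd.
\<close>

locale scalar_line_prime = scalar_line +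
  assumes prime_p: "Factorial_Ring.prime p"
    and even_case: "p = 2 \<Longrightarrow>
      \<exists>u\<in>carrier R. \<exists>v\<in>carrier R. t = u \<otimes> v \<and> u \<otimes> t = \<zero> \<and> v \<otimes> t = \<zero>"
begin

lemma D_p_multiple:
  assumes y: "y \<in> carrier R"
  shows "D (p \<bullet> y) \<approx>\<^sub>2 0"
proof -
  obtain n :: nat where n: "y \<otimes> t = n \<bullet> t"
    using scalar[OF y] by blast
  have "frag_cmul (int ((p choose 2) * n * n)) (D t) \<approx>\<^sub>2 0"
  proof (cases "p = 2")
    case True
    then have "D t \<approx>\<^sub>2 0"
      using even_case D_t_zero_of_factorisation by blast
    from K2_eq_cmul[OF this, of "(p choose 2) * n * n"] show ?thesis
      by (simp del: of_nat_mult)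
  next
    case False
    then have "2 < p" using prime_p prime_ge_2_nat[of p] by linarith
    then have "p dvd (p choose 2)"
      using prime_p by (intro dvd_choose_prime) auto
    then obtain k where k: "(p choose 2) * n * n = p * k"
      by (metis dvdE mult.assoc)
    show ?thesis unfolding k by (rule D_p_torsion) simp
  qed
  moreover have "frag_cmul (int p) (D y) \<approx>\<^sub>2 0"
    using D_p_torsion[OF y, of 1] by simp
  ultimately have "frag_cmul (int p) (D y) + frag_cmul (int ((p choose 2) * n * n)) (D t) \<approx>\<^sub>2 0 + 0"
    by (rule K2_eq_add[rotated])
  with D_multiple[OF y n, of p] show ?thesis
    using K2_eq_trans by fastforce
qed

lemma D_add_p_multiple:
  assumes x: "x \<in> carrier R" and y: "y \<in> carrier R"
  shows "D (x \<oplus> p \<bullet> y) \<approx>\<^sub>2 D x"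
proof -
  obtain i n :: nat where i: "x \<otimes> t = i \<bullet> t" and n: "y \<otimes> t = n \<bullet> t"
    using scalar x y by meson
  have "D (x \<oplus> p \<bullet> y) \<approx>\<^sub>2 D x + D (p \<bullet> y) + frag_cmul (int (i * (n * p))) (D t)"
    using x y by (intro D_add i add_pow_times_t n) auto
  also have "i * (n * p) = p * (i * n)" by simp
  also have "D x + D (p \<bullet> y) + frag_cmul (int (p * (i * n))) (D t) \<approx>\<^sub>2 D x + 0 + 0"
    by (intro K2_eq_add K2_eq_refl D_p_multiple y D_p_torsion t_closed)
  finally show ?thesis by simp
qed

lemma symbol_add_p_multiple:
  assumes x: "x \<in> carrier R" and y: "y \<in> carrier R" and s: "s \<in> \<aa>"
  shows "frag_of (x \<oplus> p \<bullet> y, s) \<approx>\<^sub>2 frag_of (x, s)"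
proof -
  obtain m :: nat where m: "s = m \<bullet> t"
    using s by (auto simp: ideal_eq_line)
  have "frag_of (x \<oplus> p \<bullet> y, s) \<approx>\<^sub>2 - frag_cmul (int m) (D (x \<oplus> p \<bullet> y))"
    unfolding m using x y by (intro symbol_line_eq_D) auto
  also have "\<dots> \<approx>\<^sub>2 - frag_cmul (int m) (D x)"
    by (intro K2_eq_minus K2_eq_cmul D_add_p_multiple x y)
  also have "\<dots> \<approx>\<^sub>2 frag_of (x, s)"
    unfolding m by (rule K2_eq_sym[OF symbol_line_eq_D[OF x]])
  finally show ?thesis .
qed

end

section \<open>Symbols under a surjection with kernel in \<open>pR\<close>\<close>

lemma (in ring_hom_cring) hom_add_pow:
  "x \<in> carrier R \<Longrightarrow> h (add_pow R (k::nat) x) = add_pow S k (h x)"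
  by (induction k) simp_all

lemma Idl_singleton_hom_image:
  assumes "cring R" "cring S" and h: "h \<in> ring_hom R S" and surj: "h ` carrier R = carrier S"
    and t: "t \<in> carrier R"
  shows "h ` (Idl\<^bsub>R\<^esub> {t}) = Idl\<^bsub>S\<^esub> {h t}"
proof -
  interpret R: cring R by fact
  interpret S: cring S by fact
  have "h ` (Idl\<^bsub>R\<^esub> {t}) = {h (x \<otimes>\<^bsub>R\<^esub> t) | x. x \<in> carrier R}"
    unfolding R.cgenideal_eq_genideal[OF t, symmetric] cgenideal_def by blast
  also have "\<dots> = {h x \<otimes>\<^bsub>S\<^esub> h t | x. x \<in> carrier R}"
    using ring_hom_mult[OF h _ t] by metis
  also have "\<dots> = {y \<otimes>\<^bsub>S\<^esub> h t | y. y \<in> carrier S}"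
    unfolding surj[symmetric] by blast
  also have "\<dots> = Idl\<^bsub>S\<^esub> {h t}"
    using S.cgenideal_eq_genideal[OF ring_hom_closed[OF h t]] by (simp add: cgenideal_def)
  finally show ?thesis .
qed

lemma DS_symbols_image:
  assumes "h ` carrier R = carrier S" "h ` \<aa> = \<bb>"
  shows "map_prod h h ` DS_symbols R \<aa> = DS_symbols S \<bb>"
  unfolding DS_symbols_def image_Un map_prod_surj_on[OF assms(1,2)] map_prod_surj_on[OF assms(2,1)] ..

text \<open>
  A relator over \<open>S\<close> is lifted to one over \<open>R\<close> by lifting its entries arbitrarily, except that those in
  \<open>\<bb>\<close> are lifted into \<open>\<aa>\<close>. For the second relation, either its common first entry or both other entries lie in
  \<open>\<bb>\<close>, and in both cases the lifted third symbol is again admissible.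
\<close>

lemma DS_relators_image:
  assumes R: "cring R" and S: "cring S" and h: "h \<in> ring_hom R S"
    and surj: "h ` carrier R = carrier S" and \<aa>: "ideal \<aa> R" and \<bb>: "h ` \<aa> = \<bb>"
  shows "frag_extend (frag_of \<circ> map_prod h h) ` DS_relators R \<aa> = DS_relators S \<bb>"
proof -
  interpret R: cring R by fact
  interpret S: cring S by fact
  interpret h: ring_hom_cring R S h by unfold_locales (rule h)
  interpret \<aa>: ideal \<aa> R by fact
  let ?\<phi> = "frag_extend (frag_of \<circ> map_prod h h)"
  have aR: "a \<in> carrier R" if "a \<in> \<aa>" for a using that \<aa>.a_Hcarr by blast
  have DSR: "(a, b) \<in> DS_symbols R \<aa> \<longleftrightarrow> a \<in> carrier R \<and> b \<in> carrier R \<and> (a \<in> \<aa> \<or> b \<in> \<aa>)" for a b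
    using aR by (auto simp: DS_symbols_def)
  have DSh: "(h a, h b) \<in> DS_symbols S \<bb>" if "(a, b) \<in> DS_symbols R \<aa>" for a b
    using that DS_symbols_image[OF surj \<bb>] by (metis image_eqI map_prod_simp)
  have hminus: "h (b \<oplus>\<^bsub>R\<^esub> c \<ominus>\<^bsub>R\<^esub> a \<otimes>\<^bsub>R\<^esub> b \<otimes>\<^bsub>R\<^esub> c) = h b \<oplus>\<^bsub>S\<^esub> h c \<ominus>\<^bsub>S\<^esub> h a \<otimes>\<^bsub>S\<^esub> h b \<otimes>\<^bsub>S\<^esub> h c"
    if "a \<in> carrier R" "b \<in> carrier R" "c \<in> carrier R" for a b c
    using that by (simp add: a_minus_def)
  have bS: "\<bb> \<subseteq> carrier S" using surj \<bb> aR by blast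
  have lift: "\<exists>x\<in>carrier R. h x = y \<and> (y \<in> \<bb> \<longrightarrow> x \<in> \<aa>)" if "y \<in> carrier S" for y
  proof (cases "y \<in> \<bb>")
    case True
    then obtain x where "x \<in> \<aa>" "h x = y" using \<bb> by blast
    then show ?thesis using aR by blast
  next
    case False
    then show ?thesis using that surj by (metis imageE)
  qed
  show ?thesis
  proof
    show "?\<phi> ` DS_relators R \<aa> \<subseteq> DS_relators S \<bb>"
    proof (intro image_subsetI)
      fix r assume "r \<in> DS_relators R \<aa>"
      then consider
        (1) a b where "r = frag_of (a, b) + frag_of (b, a)" "(a, b) \<in> DS_symbols R \<aa>"
      | (2) a b c where "r = frag_of (a, b) + frag_of (a, c)
            - frag_of (a, b \<oplus>\<^bsub>R\<^esub> c \<ominus>\<^bsub>R\<^esub> a \<otimes>\<^bsub>R\<^esub> b \<otimes>\<^bsub>R\<^esub> c)"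
          "(a, b) \<in> DS_symbols R \<aa>" "(a, c) \<in> DS_symbols R \<aa>"
          "(a, b \<oplus>\<^bsub>R\<^esub> c \<ominus>\<^bsub>R\<^esub> a \<otimes>\<^bsub>R\<^esub> b \<otimes>\<^bsub>R\<^esub> c) \<in> DS_symbols R \<aa>"
      | (3) a b c where "r = frag_of (a, b \<otimes>\<^bsub>R\<^esub> c) - (frag_of (a \<otimes>\<^bsub>R\<^esub> b, c) + frag_of (a \<otimes>\<^bsub>R\<^esub> c, b))"
          "a \<in> carrier R" "b \<in> carrier R" "c \<in> carrier R" "a \<in> \<aa> \<or> b \<in> \<aa> \<or> c \<in> \<aa>"
        unfolding DS_relators_def by blast
      then show "?\<phi> r \<in> DS_relators S \<bb>"
      proof cases
        case 1
        then have "?\<phi> r = frag_of (h a, h b) + frag_of (h b, h a)"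
          by (simp add: frag_extend_add)
        with DSh[OF 1(2)] show ?thesis unfolding DS_relators_def by blast
      next
        case 2
        then have R: "a \<in> carrier R" "b \<in> carrier R" "c \<in> carrier R" by (auto simp: DSR)
        have "?\<phi> r = frag_of (h a, h b) + frag_of (h a, h c)
            - frag_of (h a, h b \<oplus>\<^bsub>S\<^esub> h c \<ominus>\<^bsub>S\<^esub> h a \<otimes>\<^bsub>S\<^esub> h b \<otimes>\<^bsub>S\<^esub> h c)"
          unfolding 2(1) by (simp add: frag_extend_add frag_extend_diff hminus[OF R])
        moreover note DSh[OF 2(2)] DSh[OF 2(3)] DSh[OF 2(4), unfolded hminus[OF R]]
        ultimately show ?thesis unfolding DS_relators_def by blast
      next
        case 3
        then have "?\<phi> r = frag_of (h a, h b \<otimes>\<^bsub>S\<^esub> h c)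
            - (frag_of (h a \<otimes>\<^bsub>S\<^esub> h b, h c) + frag_of (h a \<otimes>\<^bsub>S\<^esub> h c, h b))"
          by (simp add: frag_extend_add frag_extend_diff)
        moreover have "h a \<in> carrier S" "h b \<in> carrier S" "h c \<in> carrier S"
            "h a \<in> \<bb> \<or> h b \<in> \<bb> \<or> h c \<in> \<bb>"
          using 3 \<bb> by auto
        ultimately show ?thesis unfolding DS_relators_def by blast
      qed
    qed
    show "DS_relators S \<bb> \<subseteq> ?\<phi> ` DS_relators R \<aa>"
    proof
      fix r assume "r \<in> DS_relators S \<bb>"
      then consider
        (1) a b where "r = frag_of (a, b) + frag_of (b, a)" "(a, b) \<in> DS_symbols S \<bb>"
      | (2) a b c where "r = frag_of (a, b) + frag_of (a, c)
            - frag_of (a, b \<oplus>\<^bsub>S\<^esub> c \<ominus>\<^bsub>S\<^esub> a \<otimes>\<^bsub>S\<^esub> b \<otimes>\<^bsub>S\<^esub> c)"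
          "(a, b) \<in> DS_symbols S \<bb>" "(a, c) \<in> DS_symbols S \<bb>"
      | (3) a b c where "r = frag_of (a, b \<otimes>\<^bsub>S\<^esub> c) - (frag_of (a \<otimes>\<^bsub>S\<^esub> b, c) + frag_of (a \<otimes>\<^bsub>S\<^esub> c, b))"
          "a \<in> carrier S" "b \<in> carrier S" "c \<in> carrier S" "a \<in> \<bb> \<or> b \<in> \<bb> \<or> c \<in> \<bb>"
        unfolding DS_relators_def by blast
      then show "r \<in> ?\<phi> ` DS_relators R \<aa>"
      proof cases
        case 1
        then obtain a' b' where l: "(a', b') \<in> DS_symbols R \<aa>" "h a' = a" "h b' = b"
        proof -
          have "(a, b) \<in> map_prod h h ` DS_symbols R \<aa>"
            unfolding DS_symbols_image[OF surj \<bb>] by (rule 1(2))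
          then show ?thesis using that by (auto elim!: imageE)
        qed
        then have "r = ?\<phi> (frag_of (a', b') + frag_of (b', a'))"
          using 1 by (simp add: frag_extend_add)
        with l(1) show ?thesis unfolding DS_relators_def by blast
      next
        case 2
        then have S: "a \<in> carrier S" "b \<in> carrier S" "c \<in> carrier S" "a \<in> \<bb> \<or> b \<in> \<bb> \<and> c \<in> \<bb>"
          using bS by (auto simp: DS_symbols_def)
        then obtain a' b' c' where l: "a' \<in> carrier R" "b' \<in> carrier R" "c' \<in> carrier R"
            "h a' = a" "h b' = b" "h c' = c" "a' \<in> \<aa> \<or> b' \<in> \<aa> \<and> c' \<in> \<aa>"
          using lift by meson
        let ?d = "b' \<oplus>\<^bsub>R\<^esub> c' \<ominus>\<^bsub>R\<^esub> a' \<otimes>\<^bsub>R\<^esub> b' \<otimes>\<^bsub>R\<^esub> c'"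
        have "a' \<in> \<aa> \<or> ?d \<in> \<aa>"
          using l \<aa>.I_l_closed \<aa>.a_closed \<aa>.a_inv_closed by (auto simp: a_minus_def)
        then have d: "(a', ?d) \<in> DS_symbols R \<aa>" "(a', b') \<in> DS_symbols R \<aa>" "(a', c') \<in> DS_symbols R \<aa>"
          using l by (auto simp: DSR)
        have "r = ?\<phi> (frag_of (a', b') + frag_of (a', c') - frag_of (a', ?d))"
          using 2(1) l(4-6) by (simp add: frag_extend_add frag_extend_diff hminus[OF l(1-3)])
        with d show ?thesis unfolding DS_relators_def by blast
      next
        case 3
        then obtain a' b' c' where l: "a' \<in> carrier R" "b' \<in> carrier R" "c' \<in> carrier R"
            "h a' = a" "h b' = b" "h c' = c" "a' \<in> \<aa> \<or> b' \<in> \<aa> \<or> c' \<in> \<aa>"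
          using lift by meson
        then have "r = ?\<phi> (frag_of (a', b' \<otimes>\<^bsub>R\<^esub> c')
            - (frag_of (a' \<otimes>\<^bsub>R\<^esub> b', c') + frag_of (a' \<otimes>\<^bsub>R\<^esub> c', b')))"
          using 3(1) by (auto simp add: frag_extend_add frag_extend_diff)
        with l show ?thesis unfolding DS_relators_def by blast
      qed
    qed
  qed
qed

text \<open>
  A lift of an entry is determined modulo \<open>pR\<close>, and the symbols do not see this ambiguity.
  A lift into \<open>(t)\<close> is unique, because \<open>t\<close> has order \<open>p\<close> and its image does not vanish.
\<close>

theorem (in scalar_line_prime) K2_rel_iso_mod_p:
  assumes S: "cring S" and h: "h \<in> ring_hom R S" and surj: "h ` carrier R = carrier S"
    and ker: "\<And>x. \<lbrakk>x \<in> carrier R; h x = \<zero>\<^bsub>S\<^esub>\<rbrakk> \<Longrightarrow> \<exists>y\<in>carrier R. x = add_pow R p y"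
    and ht: "h t \<noteq> \<zero>\<^bsub>S\<^esub>"
  shows "K2_rel R (Idl {t}) \<cong> K2_rel S (Idl\<^bsub>S\<^esub> {h t})"
proof -
  have R: "cring R" ..
  interpret h: ring_hom_cring R S h
    by (intro ring_hom_cring.intro ring_hom_cring_axioms.intro R S h)
  note img = Idl_singleton_hom_image[OF R S h surj t_closed]
  have left: "frag_of (x, s) \<approx>\<^sub>2 frag_of (x', s)"
    if "x \<in> carrier R" "x' \<in> carrier R" "h x = h x'" "s \<in> \<aa>" for x x' s
  proof -
    have "h (x \<ominus> x') = \<zero>\<^bsub>S\<^esub>"
      using that by (simp add: a_minus_def h.S.r_neg)
    then obtain y where y: "y \<in> carrier R" "x \<ominus> x' = p \<bullet> y"
      using ker[of "x \<ominus> x'"] \<open>x \<in> carrier R\<close> \<open>x' \<in> carrier R\<close> by auto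
    have "x = x' \<oplus> (x \<ominus> x')"
      using that(1,2) by algebra
    then show ?thesis
      using symbol_add_p_multiple[OF that(2) y(1) that(4)] y(2) by simp
  qed
  have right: "frag_of (s, x) \<approx>\<^sub>2 frag_of (s, x')"
    if "x \<in> carrier R" "x' \<in> carrier R" "h x = h x'" "s \<in> \<aa>" for x x' s
  proof -
    have "frag_of (s, x) \<approx>\<^sub>2 - frag_of (x, s)"
      using that by (intro DS1) (auto simp: DS_symbols_def)
    also have "\<dots> \<approx>\<^sub>2 - frag_of (x', s)"
      by (intro K2_eq_minus left that)
    also have "\<dots> \<approx>\<^sub>2 frag_of (s, x')"
      using that by (intro K2_eq_sym[OF DS1]) (auto simp: DS_symbols_def)
    finally show ?thesis .
  qed
  have inj: "y = y'" if y: "y \<in> \<aa>" and y': "y' \<in> \<aa>" and eq: "h y = h y'" for y y'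
  proof -
    have yR: "y \<in> carrier R" "y' \<in> carrier R" using y y' ideal_in_carrier by auto
    interpret I: ideal \<aa> R by (rule ideal_aa)
    have "y \<ominus> y' \<in> \<aa>"
      using y y' by (simp add: a_minus_def)
    then obtain m :: nat where m: "y \<ominus> y' = m \<bullet> t"
      unfolding ideal_eq_line by blast
    note hmult = h.hom_add_pow[OF t_closed]
    have "add_pow S m (h t) = \<zero>\<^bsub>S\<^esub>"
      using hmult[of m] yR eq by (simp add: m[symmetric] a_minus_def h.S.r_neg)
    then have "h.S.add.ord (h t) dvd m"
      using h.S.add.pow_eq_id[of "h t" m] by simp
    moreover have "h.S.add.ord (h t) dvd p"
      using h.S.add.pow_eq_id[of "h t" p] hmult[of p] p_torsion by simp
    moreover have "h.S.add.ord (h t) \<noteq> 1"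
      using h.S.add.ord_eq_1[of "h t"] ht by simp
    ultimately have "p dvd m"
      using prime_p by (metis prime_nat_iff)
    then obtain k where "m = p * k" ..
    then have "m \<bullet> t = k \<bullet> (p \<bullet> t)"
      using add_pow_mult[of t p k] by simp
    then have "y \<ominus> y' = \<zero>"
      using m p_torsion by simp
    then show ?thesis using yR by simp
  qed
  have collapse: "frag_of (x, y) \<approx>\<^sub>2 frag_of (x', y')"
    if "(x, y) \<in> DS_symbols R \<aa>" "(x', y') \<in> DS_symbols R \<aa>" "h x = h x'" "h y = h y'" for x y x' y'
  proof -
    have R: "x \<in> carrier R" "y \<in> carrier R" "x' \<in> carrier R" "y' \<in> carrier R"
      using that(1,2) ideal_in_carrier by (auto simp: DS_symbols_def)
    have "x \<in> \<aa> \<or> y \<in> \<aa>" "x' \<in> \<aa> \<or> y' \<in> \<aa>"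
      using that(1,2) by (auto simp: DS_symbols_def)
    then consider "x \<in> \<aa>" "x' \<in> \<aa>" | "y \<in> \<aa>" "y' \<in> \<aa>" | "x \<in> \<aa>" "y' \<in> \<aa>" | "y \<in> \<aa>" "x' \<in> \<aa>"
      by blast
    then show ?thesis
    proof cases
      case 1
      then show ?thesis using inj[of x x'] right[of y y' x] R that(3,4) by simp
    next
      case 2
      then show ?thesis using inj[of y y'] left[of x x' y] R that(3,4) by simp
    next
      \<comment> \<open>The two pairs meet in \<open>(x, y')\<close>, both of whose entries lie in the ideal.\<close>
      case 3
      then show ?thesis
        using K2_eq_trans[OF right[of y y' x] left[of x x' y']] R that(3,4) by simp
    next
      case 4
      then show ?thesis
        using K2_eq_trans[OF left[of x x' y] right[of y y' x']] R that(3,4) by simp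
    qed
  qed
  have "chains Mod null_chains
      \<cong> free_Abelian_group (DS_symbols S (Idl\<^bsub>S\<^esub> {h t})) Mod
          generate (free_Abelian_group (DS_symbols S (Idl\<^bsub>S\<^esub> {h t}))) (DS_relators S (Idl\<^bsub>S\<^esub> {h t}))"
  proof (rule free_Abelian_presentation_iso)
    show "map_prod h h ` DS_symbols R \<aa> = DS_symbols S (Idl\<^bsub>S\<^esub> {h t})"
      by (rule DS_symbols_image[OF surj img])
    show "frag_extend (frag_of \<circ> map_prod h h) ` DS_relators R \<aa> = DS_relators S (Idl\<^bsub>S\<^esub> {h t})"
      by (rule DS_relators_image[OF R S h surj ideal_aa img])
    show "DS_relators R \<aa> \<subseteq> carrier chains"
      by (rule DS_relators_closed)
    show "frag_of z - frag_of z' \<in> null_chains"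
      if "z \<in> DS_symbols R \<aa>" "z' \<in> DS_symbols R \<aa>" "map_prod h h z = map_prod h h z'" for z z'
      using that collapse[of "fst z" "snd z" "fst z'" "snd z'"] unfolding K2_eq_def
      by (cases z; cases z') simp
  qed
  then show ?thesis unfolding K2_rel_def .
qed

section \<open>Group rings of finite abelian groups\<close>

lemma (in abelian_monoid) finsum_swap:
  assumes "finite A" "finite B" "\<And>x y. x \<in> A \<Longrightarrow> y \<in> B \<Longrightarrow> f x y \<in> carrier G"
  shows "(\<Oplus>x\<in>A. \<Oplus>y\<in>B. f x y) = (\<Oplus>y\<in>B. \<Oplus>x\<in>A. f x y)"
  using assms(1,3)
proof (induction A rule: finite_induct)
  case empty
  then show ?case by (simp add: finsum_zero)
next
  case (insert a A)
  have "(\<Oplus>y\<in>B. \<Oplus>x\<in>insert a A. f x y) = (\<Oplus>y\<in>B. f a y \<oplus> (\<Oplus>x\<in>A. f x y))"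
    using insert by (intro finsum_cong') (auto simp: Pi_def)
  also have "\<dots> = (\<Oplus>y\<in>B. f a y) \<oplus> (\<Oplus>y\<in>B. \<Oplus>x\<in>A. f x y)"
    using insert by (intro finsum_addf) auto
  finally show ?case
    using insert assms(2) by (simp add: Pi_def)
qed

locale finite_group_ring = R: cring R + G: comm_group G
  for R :: "('r, 'a) ring_scheme" and G :: "('g, 'b) monoid_scheme" +
  assumes finite_G [simp]: "finite (carrier G)"
begin

abbreviation "RG \<equiv> group_ring R G"

lemma carrier_group_ring: "carrier RG = carrier G \<rightarrow>\<^sub>E carrier R"
  by (simp add: group_ring_def)

lemma group_ring_closed: "f \<in> carrier RG \<Longrightarrow> x \<in> carrier G \<Longrightarrow> f x \<in> carrier R"
  by (auto simp: carrier_group_ring)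

lemma group_ring_eqI:
  assumes "f \<in> carrier RG" "h \<in> carrier RG" "\<And>x. x \<in> carrier G \<Longrightarrow> f x = h x"
  shows "f = h"
  using assms by (auto simp: carrier_group_ring intro: PiE_ext)

lemma mult_group_ring:
  "f \<otimes>\<^bsub>RG\<^esub> h = (\<lambda>g\<in>carrier G. \<Oplus>\<^bsub>R\<^esub>x\<in>carrier G. f x \<otimes>\<^bsub>R\<^esub> h (inv\<^bsub>G\<^esub> x \<otimes>\<^bsub>G\<^esub> g))"
  by (simp add: group_ring_def)

lemma add_group_ring: "f \<oplus>\<^bsub>RG\<^esub> h = (\<lambda>g\<in>carrier G. f g \<oplus>\<^bsub>R\<^esub> h g)"
  by (simp add: group_ring_def)

lemma zero_group_ring: "\<zero>\<^bsub>RG\<^esub> = (\<lambda>g\<in>carrier G. \<zero>\<^bsub>R\<^esub>)"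
  by (simp add: group_ring_def)

lemma one_group_ring: "\<one>\<^bsub>RG\<^esub> = group_ring_of R G \<one>\<^bsub>G\<^esub>"
  by (simp add: group_ring_def group_ring_of_def)

lemma group_ring_of_closed: "group_ring_of R G g \<in> carrier RG"
  by (simp add: carrier_group_ring group_ring_of_def)

lemma mult_group_ring_closed:
  assumes "f \<in> carrier RG" "h \<in> carrier RG"
  shows "f \<otimes>\<^bsub>RG\<^esub> h \<in> carrier RG"
  unfolding mult_group_ring
  by (subst carrier_group_ring, intro restrict_PiE_iff[THEN iffD2] ballI R.finsum_closed)
     (use assms group_ring_closed in auto)

lemma finsum_translate:
  assumes "y \<in> carrier G" "\<And>x. x \<in> carrier G \<Longrightarrow> F x \<in> carrier R"
  shows "(\<Oplus>\<^bsub>R\<^esub>x\<in>carrier G. F (y \<otimes>\<^bsub>G\<^esub> x)) = (\<Oplus>\<^bsub>R\<^esub>x\<in>carrier G. F x)"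
proof -
  have "F \<in> (\<lambda>x. y \<otimes>\<^bsub>G\<^esub> x) ` carrier G \<rightarrow> carrier R"
    using assms by auto
  from R.finsum_reindex[OF this G.inj_on_cmult[OF assms(1)]] show ?thesis
    unfolding G.surj_const_mult[OF assms(1)] by (rule sym)
qed

lemma finsum_reflect:
  assumes "y \<in> carrier G" "\<And>x. x \<in> carrier G \<Longrightarrow> F x \<in> carrier R"
  shows "(\<Oplus>\<^bsub>R\<^esub>x\<in>carrier G. F (inv\<^bsub>G\<^esub> x \<otimes>\<^bsub>G\<^esub> y)) = (\<Oplus>\<^bsub>R\<^esub>x\<in>carrier G. F x)"
proof -
  let ?r = "\<lambda>x. inv\<^bsub>G\<^esub> x \<otimes>\<^bsub>G\<^esub> y"
  have r: "?r x \<in> carrier G \<and> ?r (?r x) = x" if "x \<in> carrier G" for x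
    using that assms(1) by (simp add: G.inv_mult_group G.m_ac)
  have surj: "?r ` carrier G = carrier G"
  proof
    show "?r ` carrier G \<subseteq> carrier G" using r by blast
    show "carrier G \<subseteq> ?r ` carrier G" using r by (metis (no_types, lifting) imageI subsetI)
  qed
  have inj: "inj_on ?r (carrier G)"
    by (rule inj_on_inverseI[where g = ?r]) (use r in blast)
  have "F \<in> ?r ` carrier G \<rightarrow> carrier R"
    using assms(2) r by blast
  from R.finsum_reindex[OF this inj] show ?thesis
    unfolding surj by (rule sym)
qed

lemma mult_group_ring_assoc:
  assumes f: "f \<in> carrier RG" and h: "h \<in> carrier RG" and k: "k \<in> carrier RG"
  shows "(f \<otimes>\<^bsub>RG\<^esub> h) \<otimes>\<^bsub>RG\<^esub> k = f \<otimes>\<^bsub>RG\<^esub> (h \<otimes>\<^bsub>RG\<^esub> k)"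
proof (rule group_ring_eqI)
  note cl = group_ring_closed[OF f] group_ring_closed[OF h] group_ring_closed[OF k]
  fix g assume g: "g \<in> carrier G"
  let ?T = "\<lambda>y x. f y \<otimes>\<^bsub>R\<^esub> (h (inv\<^bsub>G\<^esub> y \<otimes>\<^bsub>G\<^esub> x) \<otimes>\<^bsub>R\<^esub> k (inv\<^bsub>G\<^esub> x \<otimes>\<^bsub>G\<^esub> g))"
  have "((f \<otimes>\<^bsub>RG\<^esub> h) \<otimes>\<^bsub>RG\<^esub> k) g
      = (\<Oplus>\<^bsub>R\<^esub>x\<in>carrier G. (\<Oplus>\<^bsub>R\<^esub>y\<in>carrier G. f y \<otimes>\<^bsub>R\<^esub> h (inv\<^bsub>G\<^esub> y \<otimes>\<^bsub>G\<^esub> x)) \<otimes>\<^bsub>R\<^esub> k (inv\<^bsub>G\<^esub> x \<otimes>\<^bsub>G\<^esub> g))"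
    using g cl by (auto simp: mult_group_ring intro!: R.finsum_cong')
  also have "\<dots> = (\<Oplus>\<^bsub>R\<^esub>x\<in>carrier G. \<Oplus>\<^bsub>R\<^esub>y\<in>carrier G. ?T y x)"
    using g cl by (intro R.finsum_cong') (auto simp: R.finsum_ldistr R.m_assoc intro!: R.finsum_cong')
  also have "\<dots> = (\<Oplus>\<^bsub>R\<^esub>y\<in>carrier G. \<Oplus>\<^bsub>R\<^esub>x\<in>carrier G. ?T y x)"
    using g cl by (intro R.finsum_swap) auto
  also have "\<dots> = (\<Oplus>\<^bsub>R\<^esub>y\<in>carrier G. f y \<otimes>\<^bsub>R\<^esub> (h \<otimes>\<^bsub>RG\<^esub> k) (inv\<^bsub>G\<^esub> y \<otimes>\<^bsub>G\<^esub> g))"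
  proof (rule R.finsum_cong')
    fix y assume y: "y \<in> carrier G"
    have "(\<Oplus>\<^bsub>R\<^esub>x\<in>carrier G. ?T y x)
        = (\<Oplus>\<^bsub>R\<^esub>x\<in>carrier G. ?T y (y \<otimes>\<^bsub>G\<^esub> x))"
      using y g cl by (intro finsum_translate[symmetric]) auto
    also have "\<dots> = (\<Oplus>\<^bsub>R\<^esub>x\<in>carrier G. f y \<otimes>\<^bsub>R\<^esub> (h x \<otimes>\<^bsub>R\<^esub> k (inv\<^bsub>G\<^esub> x \<otimes>\<^bsub>G\<^esub> (inv\<^bsub>G\<^esub> y \<otimes>\<^bsub>G\<^esub> g))))"
      using y g cl by (intro R.finsum_cong') (auto simp: G.m_assoc[symmetric] G.inv_mult_group)
    also have "\<dots> = f y \<otimes>\<^bsub>R\<^esub> (h \<otimes>\<^bsub>RG\<^esub> k) (inv\<^bsub>G\<^esub> y \<otimes>\<^bsub>G\<^esub> g)"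
      using y g cl by (simp add: mult_group_ring R.finsum_rdistr Pi_def)
    finally show "(\<Oplus>\<^bsub>R\<^esub>x\<in>carrier G. ?T y x) = f y \<otimes>\<^bsub>R\<^esub> (h \<otimes>\<^bsub>RG\<^esub> k) (inv\<^bsub>G\<^esub> y \<otimes>\<^bsub>G\<^esub> g)" .
  qed (use g cl group_ring_closed[OF mult_group_ring_closed[OF h k]] in auto)
  also have "\<dots> = (f \<otimes>\<^bsub>RG\<^esub> (h \<otimes>\<^bsub>RG\<^esub> k)) g"
    using g by (simp add: mult_group_ring)
  finally show "((f \<otimes>\<^bsub>RG\<^esub> h) \<otimes>\<^bsub>RG\<^esub> k) g = (f \<otimes>\<^bsub>RG\<^esub> (h \<otimes>\<^bsub>RG\<^esub> k)) g" .
qed (intro mult_group_ring_closed assms)+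

lemma mult_group_ring_comm:
  assumes f: "f \<in> carrier RG" and h: "h \<in> carrier RG"
  shows "f \<otimes>\<^bsub>RG\<^esub> h = h \<otimes>\<^bsub>RG\<^esub> f"
proof (rule group_ring_eqI)
  note cl = group_ring_closed[OF f] group_ring_closed[OF h]
  fix g assume g: "g \<in> carrier G"
  have "(f \<otimes>\<^bsub>RG\<^esub> h) g = (\<Oplus>\<^bsub>R\<^esub>x\<in>carrier G. f x \<otimes>\<^bsub>R\<^esub> h (inv\<^bsub>G\<^esub> x \<otimes>\<^bsub>G\<^esub> g))"
    using g by (simp add: mult_group_ring)
  also have "\<dots> = (\<Oplus>\<^bsub>R\<^esub>x\<in>carrier G. f (inv\<^bsub>G\<^esub> x \<otimes>\<^bsub>G\<^esub> g) \<otimes>\<^bsub>R\<^esub> h (inv\<^bsub>G\<^esub> (inv\<^bsub>G\<^esub> x \<otimes>\<^bsub>G\<^esub> g) \<otimes>\<^bsub>G\<^esub> g))"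
    using g cl by (intro finsum_reflect[symmetric]) auto
  also have "\<dots> = (\<Oplus>\<^bsub>R\<^esub>x\<in>carrier G. h x \<otimes>\<^bsub>R\<^esub> f (inv\<^bsub>G\<^esub> x \<otimes>\<^bsub>G\<^esub> g))"
    using g cl by (intro R.finsum_cong') (auto simp: G.inv_mult_group G.m_ac R.m_comm)
  also have "\<dots> = (h \<otimes>\<^bsub>RG\<^esub> f) g"
    using g by (simp add: mult_group_ring)
  finally show "(f \<otimes>\<^bsub>RG\<^esub> h) g = (h \<otimes>\<^bsub>RG\<^esub> f) g" .
qed (intro mult_group_ring_closed assms)+

lemma group_ring_of_mult:
  assumes g: "g \<in> carrier G" and f: "f \<in> carrier RG"
  shows "group_ring_of R G g \<otimes>\<^bsub>RG\<^esub> f = (\<lambda>x\<in>carrier G. f (inv\<^bsub>G\<^esub> g \<otimes>\<^bsub>G\<^esub> x))"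
proof -
  have "(\<Oplus>\<^bsub>R\<^esub>x\<in>carrier G. group_ring_of R G g x \<otimes>\<^bsub>R\<^esub> f (inv\<^bsub>G\<^esub> x \<otimes>\<^bsub>G\<^esub> y)) = f (inv\<^bsub>G\<^esub> g \<otimes>\<^bsub>G\<^esub> y)"
    if y: "y \<in> carrier G" for y
  proof -
    have "(\<Oplus>\<^bsub>R\<^esub>x\<in>carrier G. group_ring_of R G g x \<otimes>\<^bsub>R\<^esub> f (inv\<^bsub>G\<^esub> x \<otimes>\<^bsub>G\<^esub> y))
        = (\<Oplus>\<^bsub>R\<^esub>x\<in>carrier G. if g = x then f (inv\<^bsub>G\<^esub> x \<otimes>\<^bsub>G\<^esub> y) else \<zero>\<^bsub>R\<^esub>)"
      using y g group_ring_closed[OF f]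
      by (intro R.finsum_cong') (auto simp: group_ring_of_def)
    also have "\<dots> = f (inv\<^bsub>G\<^esub> g \<otimes>\<^bsub>G\<^esub> y)"
      using y g group_ring_closed[OF f]
      by (intro R.finsum_singleton) auto
    finally show ?thesis .
  qed
  then show ?thesis by (auto simp: mult_group_ring)
qed

lemma cring_group_ring: "cring RG"
proof (rule cringI)
  show "abelian_group RG"
  proof (rule abelian_groupI)
    fix f assume f: "f \<in> carrier RG"
    have "(\<lambda>x\<in>carrier G. \<ominus>\<^bsub>R\<^esub> f x) \<in> carrier RG"
      using f by (auto simp: carrier_group_ring)
    moreover have "(\<lambda>x\<in>carrier G. \<ominus>\<^bsub>R\<^esub> f x) \<oplus>\<^bsub>RG\<^esub> f = \<zero>\<^bsub>RG\<^esub>"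
      using group_ring_closed[OF f] by (auto simp: add_group_ring zero_group_ring R.l_neg)
    ultimately show "\<exists>y\<in>carrier RG. y \<oplus>\<^bsub>RG\<^esub> f = \<zero>\<^bsub>RG\<^esub>" by blast
  next
    fix f h assume fh: "f \<in> carrier RG" "h \<in> carrier RG"
    then show "f \<oplus>\<^bsub>RG\<^esub> h = h \<oplus>\<^bsub>RG\<^esub> f"
      unfolding add_group_ring
      using group_ring_closed by (intro restrict_ext) (simp add: R.a_comm)
  next
    show "\<zero>\<^bsub>RG\<^esub> \<in> carrier RG"
      by (simp add: zero_group_ring carrier_group_ring)
  next
    fix f assume f: "f \<in> carrier RG"
    then show "\<zero>\<^bsub>RG\<^esub> \<oplus>\<^bsub>RG\<^esub> f = f"
      using group_ring_closed[OF f]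
      by (intro group_ring_eqI[OF _ f]) (auto simp: add_group_ring zero_group_ring carrier_group_ring)
  next
    fix f h k assume fhk: "f \<in> carrier RG" "h \<in> carrier RG" "k \<in> carrier RG"
    then show "f \<oplus>\<^bsub>RG\<^esub> h \<oplus>\<^bsub>RG\<^esub> k = f \<oplus>\<^bsub>RG\<^esub> (h \<oplus>\<^bsub>RG\<^esub> k)"
      unfolding add_group_ring
      using group_ring_closed by (intro restrict_ext) (simp add: R.a_assoc)
  next
    fix f h assume "f \<in> carrier RG" "h \<in> carrier RG"
    then show "f \<oplus>\<^bsub>RG\<^esub> h \<in> carrier RG"
      unfolding add_group_ring carrier_group_ring
      by (intro restrict_PiE_iff[THEN iffD2] ballI R.a_closed) auto
  qed
  show "comm_monoid RG"
  proof (rule comm_monoidI)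
    show "\<one>\<^bsub>RG\<^esub> \<in> carrier RG"
      by (simp add: one_group_ring group_ring_of_closed)
    show "\<one>\<^bsub>RG\<^esub> \<otimes>\<^bsub>RG\<^esub> f = f" if f: "f \<in> carrier RG" for f
      unfolding one_group_ring group_ring_of_mult[OF G.one_closed f]
      by (rule group_ring_eqI[OF _ f]) (use f in \<open>auto simp: carrier_group_ring\<close>)
  qed (fact mult_group_ring_closed mult_group_ring_assoc mult_group_ring_comm)+
  fix f h k assume f: "f \<in> carrier RG" and h: "h \<in> carrier RG" and k: "k \<in> carrier RG"
  note cl = group_ring_closed[OF f] group_ring_closed[OF h] group_ring_closed[OF k]
  have "(\<Oplus>\<^bsub>R\<^esub>x\<in>carrier G. (f x \<oplus>\<^bsub>R\<^esub> h x) \<otimes>\<^bsub>R\<^esub> k (inv\<^bsub>G\<^esub> x \<otimes>\<^bsub>G\<^esub> g))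
      = (\<Oplus>\<^bsub>R\<^esub>x\<in>carrier G. f x \<otimes>\<^bsub>R\<^esub> k (inv\<^bsub>G\<^esub> x \<otimes>\<^bsub>G\<^esub> g)) \<oplus>\<^bsub>R\<^esub>
        (\<Oplus>\<^bsub>R\<^esub>x\<in>carrier G. h x \<otimes>\<^bsub>R\<^esub> k (inv\<^bsub>G\<^esub> x \<otimes>\<^bsub>G\<^esub> g))" if g: "g \<in> carrier G" for g
  proof -
    have "(\<Oplus>\<^bsub>R\<^esub>x\<in>carrier G. (f x \<oplus>\<^bsub>R\<^esub> h x) \<otimes>\<^bsub>R\<^esub> k (inv\<^bsub>G\<^esub> x \<otimes>\<^bsub>G\<^esub> g))
       = (\<Oplus>\<^bsub>R\<^esub>x\<in>carrier G. f x \<otimes>\<^bsub>R\<^esub> k (inv\<^bsub>G\<^esub> x \<otimes>\<^bsub>G\<^esub> g) \<oplus>\<^bsub>R\<^esub> h x \<otimes>\<^bsub>R\<^esub> k (inv\<^bsub>G\<^esub> x \<otimes>\<^bsub>G\<^esub> g))"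
      using g cl by (intro R.finsum_cong') (auto simp: R.l_distr)
    also have "\<dots> = (\<Oplus>\<^bsub>R\<^esub>x\<in>carrier G. f x \<otimes>\<^bsub>R\<^esub> k (inv\<^bsub>G\<^esub> x \<otimes>\<^bsub>G\<^esub> g)) \<oplus>\<^bsub>R\<^esub>
        (\<Oplus>\<^bsub>R\<^esub>x\<in>carrier G. h x \<otimes>\<^bsub>R\<^esub> k (inv\<^bsub>G\<^esub> x \<otimes>\<^bsub>G\<^esub> g))"
      using g cl by (intro R.finsum_addf) auto
    finally show ?thesis .
  qed
  moreover have "(\<Oplus>\<^bsub>R\<^esub>x\<in>carrier G. (f \<oplus>\<^bsub>RG\<^esub> h) x \<otimes>\<^bsub>R\<^esub> k (inv\<^bsub>G\<^esub> x \<otimes>\<^bsub>G\<^esub> g))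
      = (\<Oplus>\<^bsub>R\<^esub>x\<in>carrier G. (f x \<oplus>\<^bsub>R\<^esub> h x) \<otimes>\<^bsub>R\<^esub> k (inv\<^bsub>G\<^esub> x \<otimes>\<^bsub>G\<^esub> g))" if "g \<in> carrier G" for g
    using that cl by (intro R.finsum_cong') (auto simp: add_group_ring)
  ultimately show "(f \<oplus>\<^bsub>RG\<^esub> h) \<otimes>\<^bsub>RG\<^esub> k = (f \<otimes>\<^bsub>RG\<^esub> k) \<oplus>\<^bsub>RG\<^esub> (h \<otimes>\<^bsub>RG\<^esub> k)"
    unfolding mult_group_ring add_group_ring[of "restrict _ _"]
    by (intro restrict_ext) simp
qed

sublocale RG: cring RG
  by (rule cring_group_ring)

lemma finsum_group_ring_apply:
  assumes "finite A" "F \<in> A \<rightarrow> carrier RG" "g \<in> carrier G"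
  shows "(\<Oplus>\<^bsub>RG\<^esub>a\<in>A. F a) g = (\<Oplus>\<^bsub>R\<^esub>a\<in>A. F a g)"
  using assms(1,2)
proof (induction A rule: finite_induct)
  case empty
  then show ?case using assms(3) by (simp add: zero_group_ring)
next
  case (insert a A)
  then have "(\<lambda>a. F a g) \<in> A \<rightarrow> carrier R" "F a g \<in> carrier R"
    using group_ring_closed assms(3) by blast+
  with insert show ?case using assms(3) by (simp add: add_group_ring)
qed

lemma add_pow_group_ring_apply:
  assumes "f \<in> carrier RG" "g \<in> carrier G"
  shows "add_pow RG (n::nat) f g = add_pow R n (f g)"
  using assms by (induction n) (auto simp: zero_group_ring add_group_ring)

lemma group_sum_apply: "group_sum R G = (\<lambda>g\<in>carrier G. \<one>\<^bsub>R\<^esub>)"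
proof (rule group_ring_eqI)
  show "group_sum R G \<in> carrier RG"
    unfolding group_sum_def by (intro RG.finsum_closed) (simp add: group_ring_of_closed)
  show "(\<lambda>g\<in>carrier G. \<one>\<^bsub>R\<^esub>) \<in> carrier RG" by (simp add: carrier_group_ring)
  fix g assume g: "g \<in> carrier G"
  have "group_sum R G g = (\<Oplus>\<^bsub>R\<^esub>a\<in>carrier G. if g = a then \<one>\<^bsub>R\<^esub> else \<zero>\<^bsub>R\<^esub>)"
    unfolding group_sum_def using g
    by (subst finsum_group_ring_apply) (auto simp: group_ring_of_closed, simp add: group_ring_of_def)
  also have "\<dots> = \<one>\<^bsub>R\<^esub>"
    using g by (intro R.finsum_singleton) auto
  finally show "group_sum R G g = (\<lambda>g\<in>carrier G. \<one>\<^bsub>R\<^esub>) g" using g by simp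
qed

lemma group_sum_closed: "group_sum R G \<in> carrier RG"
  by (simp add: group_sum_apply carrier_group_ring)

lemma mult_group_sum:
  assumes f: "f \<in> carrier RG"
  shows "f \<otimes>\<^bsub>RG\<^esub> group_sum R G = (\<lambda>g\<in>carrier G. \<Oplus>\<^bsub>R\<^esub>x\<in>carrier G. f x)"
proof -
  have "(\<Oplus>\<^bsub>R\<^esub>x\<in>carrier G. f x \<otimes>\<^bsub>R\<^esub> group_sum R G (inv\<^bsub>G\<^esub> x \<otimes>\<^bsub>G\<^esub> g)) = (\<Oplus>\<^bsub>R\<^esub>x\<in>carrier G. f x)"
    if "g \<in> carrier G" for g
    using that group_ring_closed[OF f] by (intro R.finsum_cong') (auto simp: group_sum_apply)
  then show ?thesis by (auto simp: mult_group_ring)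
qed

lemma group_ring_of_mult_group_ring_of:
  assumes "g \<in> carrier G" "h \<in> carrier G"
  shows "group_ring_of R G g \<otimes>\<^bsub>RG\<^esub> group_ring_of R G h = group_ring_of R G (g \<otimes>\<^bsub>G\<^esub> h)"
proof -
  have "inv\<^bsub>G\<^esub> g \<otimes>\<^bsub>G\<^esub> x = h \<longleftrightarrow> x = g \<otimes>\<^bsub>G\<^esub> h" if "x \<in> carrier G" for x
    using that assms by (metis G.inv_solve_left)
  then show ?thesis
    unfolding group_ring_of_mult[OF assms(1) group_ring_of_closed]
    using assms by (auto simp: group_ring_of_def)
qed

end

section \<open>Rational and integral coefficients\<close>

lemma cring_rat_field: "cring rat_field"
  unfolding rat_field_def by (rule cring_from_type_algebra)

lemma rat_field_simps [simp]:
  "carrier rat_field = UNIV" "\<zero>\<^bsub>rat_field\<^esub> = 0" "\<one>\<^bsub>rat_field\<^esub> = 1"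
  "x \<oplus>\<^bsub>rat_field\<^esub> y = x + y" "x \<otimes>\<^bsub>rat_field\<^esub> y = x * y"
  by (simp_all add: rat_field_def ring_of_type_algebra_def)

lemma int_subring_simps [simp]:
  "carrier int_subring = \<int>" "\<zero>\<^bsub>int_subring\<^esub> = 0" "\<one>\<^bsub>int_subring\<^esub> = 1"
  "x \<oplus>\<^bsub>int_subring\<^esub> y = x + y" "x \<otimes>\<^bsub>int_subring\<^esub> y = x * y"
  by (simp_all add: int_subring_def rat_field_def ring_of_type_algebra_def)

lemma cring_int_subring: "cring int_subring"
proof (rule cringI)
  show "abelian_group int_subring"
    by (rule abelian_groupI) (auto intro: bexI[of _ "- x" for x])
  show "comm_monoid int_subring"
    by (rule comm_monoidI) auto
qed (auto simp: algebra_simps)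

lemma finsum_rat_field: "finite A \<Longrightarrow> (\<Oplus>\<^bsub>rat_field\<^esub>a\<in>A. F a) = sum F A"
proof (induction A rule: finite_induct)
  interpret cring rat_field by (rule cring_rat_field)
  case empty
  show ?case by simp
next
  interpret cring rat_field by (rule cring_rat_field)
  case (insert a A)
  then show ?case by simp
qed

lemma finsum_int_subring:
  "\<lbrakk>finite A; \<And>a. a \<in> A \<Longrightarrow> F a \<in> \<int>\<rbrakk> \<Longrightarrow> (\<Oplus>\<^bsub>int_subring\<^esub>a\<in>A. F a) = sum F A"
proof (induction A rule: finite_induct)
  interpret cring int_subring by (rule cring_int_subring)
  case empty
  show ?case by simp
next
  interpret cring int_subring by (rule cring_int_subring)
  case (insert a A)
  then show ?case by (simp add: Pi_def)
qed

lemma add_pow_rat_field: "add_pow rat_field (n::nat) q = of_nat n * q"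
  by (induction n) (simp_all add: add_pow_def nat_pow_def algebra_simps)

lemma add_pow_int_subring: "add_pow int_subring (n::nat) q = of_nat n * q"
  by (induction n) (simp_all add: add_pow_def nat_pow_def algebra_simps)

lemma a_inv_rat_field: "\<ominus>\<^bsub>rat_field\<^esub> q = - q"
proof -
  interpret cring rat_field by (rule cring_rat_field)
  show ?thesis using minus_unique[of "- q" q "\<ominus>\<^bsub>rat_field\<^esub> q"] r_neg[of q] by simp
qed

lemma add_pow_rat_field_int: "add_pow rat_field (k::int) q = of_int k * q"
  by (cases "k \<ge> 0") (simp_all add: add_pow_int_ge add_pow_int_lt add_pow_rat_field a_inv_rat_field)

lemma (in finite_group_ring) add_pow_group_ring_apply_int:
  assumes "f \<in> carrier RG" "g \<in> carrier G"
  shows "add_pow RG (k::int) f g = add_pow R k (f g)"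
proof -
  have "group_hom (add_monoid RG) (add_monoid R) (\<lambda>f. f g)"
    using assms(2) group_ring_closed
    by (intro group_hom.intro group_hom_axioms.intro homI RG.a_group R.a_group)
       (auto simp: add_group_ring)
  from group_hom.hom_int_pow[OF this, of f k] show ?thesis
    using assms(1) by (simp add: add_pow_def)
qed

lemma group_ring_map_hom:
  assumes "finite_group_ring R G" "finite_group_ring S G" and r: "r \<in> ring_hom R S"
  shows "(\<lambda>f. \<lambda>g\<in>carrier G. r (f g)) \<in> ring_hom (group_ring R G) (group_ring S G)"
proof -
  interpret R: finite_group_ring R G by fact
  interpret S: finite_group_ring S G by fact
  interpret r: ring_hom_cring R S r
    by (intro ring_hom_cring.intro ring_hom_cring_axioms.intro R.R.is_cring S.R.is_cring r)
  let ?\<phi> = "\<lambda>f. \<lambda>g\<in>carrier G. r (f g)"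
  have closed: "?\<phi> f \<in> carrier (group_ring S G)" if "f \<in> carrier (group_ring R G)" for f
    using R.group_ring_closed[OF that] by (auto simp: S.carrier_group_ring)
  show ?thesis
  proof (rule ring_hom_memI)
    fix f h assume f: "f \<in> carrier (group_ring R G)" and h: "h \<in> carrier (group_ring R G)"
    note cl = R.group_ring_closed[OF f] R.group_ring_closed[OF h]
    show "?\<phi> (f \<oplus>\<^bsub>group_ring R G\<^esub> h) = ?\<phi> f \<oplus>\<^bsub>group_ring S G\<^esub> ?\<phi> h"
      unfolding R.add_group_ring S.add_group_ring by (intro restrict_ext) (simp add: cl)
    have "r (\<Oplus>\<^bsub>R\<^esub>x\<in>carrier G. f x \<otimes>\<^bsub>R\<^esub> h (inv\<^bsub>G\<^esub> x \<otimes>\<^bsub>G\<^esub> g))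
       = (\<Oplus>\<^bsub>S\<^esub>x\<in>carrier G. ?\<phi> f x \<otimes>\<^bsub>S\<^esub> ?\<phi> h (inv\<^bsub>G\<^esub> x \<otimes>\<^bsub>G\<^esub> g))" if "g \<in> carrier G" for g
      using that cl
      by (subst r.hom_finsum) (auto intro!: S.R.finsum_cong')
    then show "?\<phi> (f \<otimes>\<^bsub>group_ring R G\<^esub> h) = ?\<phi> f \<otimes>\<^bsub>group_ring S G\<^esub> ?\<phi> h"
      unfolding R.mult_group_ring S.mult_group_ring by (intro restrict_ext) simp
  next
    show "?\<phi> \<one>\<^bsub>group_ring R G\<^esub> = \<one>\<^bsub>group_ring S G\<^esub>"
      unfolding R.one_group_ring S.one_group_ring group_ring_of_def by (intro restrict_ext) auto
  qed (rule closed)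
qed

lemma floor_mod_ring_hom:
  assumes "1 < m"
  shows "(\<lambda>q. \<lfloor>q\<rfloor> mod m) \<in> ring_hom int_subring (residue_ring m)"
proof (rule ring_hom_memI)
  fix x y :: rat assume "x \<in> carrier int_subring" "y \<in> carrier int_subring"
  then obtain a b :: int where [simp]: "x = of_int a" "y = of_int b"
    by (auto elim!: Ints_cases)
  show "\<lfloor>x \<otimes>\<^bsub>int_subring\<^esub> y\<rfloor> mod m = (\<lfloor>x\<rfloor> mod m) \<otimes>\<^bsub>residue_ring m\<^esub> (\<lfloor>y\<rfloor> mod m)"
    by (simp add: residue_ring_def mod_mult_eq flip: of_int_mult)
  show "\<lfloor>x \<oplus>\<^bsub>int_subring\<^esub> y\<rfloor> mod m = (\<lfloor>x\<rfloor> mod m) \<oplus>\<^bsub>residue_ring m\<^esub> (\<lfloor>y\<rfloor> mod m)"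
    by (simp add: residue_ring_def mod_add_eq flip: of_int_add)
qed (use assms in \<open>auto simp: residue_ring_def\<close>)

section \<open>Finite submonoids of maximal orders\<close>

lemma (in cring) generate_mult_closed:
  assumes H: "H \<subseteq> carrier R" and mult: "\<And>x y. x \<in> H \<Longrightarrow> y \<in> K \<Longrightarrow> x \<otimes> y \<in> generate (add_monoid R) L"
    and K: "K \<subseteq> carrier R" and L: "L \<subseteq> carrier R"
    and x: "x \<in> generate (add_monoid R) H" and y: "y \<in> generate (add_monoid R) K"
  shows "x \<otimes> y \<in> generate (add_monoid R) L"
proof -
  interpret A: additive_subgroup "generate (add_monoid R) L" R
    by (intro additive_subgroup.intro add.generate_is_subgroup L)
  have cl: "u \<in> carrier R" if "u \<in> generate (add_monoid R) M" "M \<subseteq> carrier R" for u M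
    using add.generate_in_carrier that by blast
  have step: "x \<otimes> b \<in> generate (add_monoid R) L" if b: "b \<in> K" for b
    using x
  proof induction
    case one
    then show ?case using b K by auto
  next
    case (incl h)
    then show ?case using mult b by blast
  next
    case (inv h)
    then have "(\<ominus> h) \<otimes> b = \<ominus> (h \<otimes> b)"
      using b H K by (intro l_minus) auto
    then show ?case
      using A.a_inv_closed[OF mult[OF inv b]] by (simp add: a_inv_def)
  next
    case (eng u v)
    then have "(u \<oplus> v) \<otimes> b = u \<otimes> b \<oplus> v \<otimes> b"
      using b K cl[OF _ H] by (intro l_distr) auto
    then show ?case using A.a_closed[OF eng.IH] by simp
  qed
  have xR: "x \<in> carrier R" using cl[OF x H] .
  show ?thesis
    using y
  proof induction
    case one
    then show ?case using xR by auto
  next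
    case (incl h)
    then show ?case by (rule step)
  next
    case (inv h)
    then have "x \<otimes> (\<ominus> h) = \<ominus> (x \<otimes> h)"
      using xR K by (intro r_minus) auto
    then show ?case
      using A.a_inv_closed[OF step[OF inv]] by (simp add: a_inv_def)
  next
    case (eng u v)
    then have "x \<otimes> (u \<oplus> v) = x \<otimes> u \<oplus> x \<otimes> v"
      using xR cl[OF _ K] by (intro r_distr) auto
    then show ?case using A.a_closed[OF eng.IH] by simp
  qed
qed

text \<open>
  Since \<open>S\<close> is finite and closed under multiplication, the products \<open>c s\<close> with \<open>c \<in> \<Gamma>\<close> and \<open>s \<in> S\<close> generate a
  subring that is still finitely generated as an abelian group. It is an order containing \<open>\<Gamma>\<close> and \<open>S\<close>, and by maximality it equals \<open>\<Gamma>\<close>.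
\<close>

lemma maximal_Z_order_contains_finite_submonoid:
  assumes "cring A" and smult: "\<And>q x. x \<in> carrier A \<Longrightarrow> q \<odot>\<^bsub>A\<^esub> x \<in> carrier A"
    and max: "maximal_Z_order A \<Gamma>"
    and S: "finite S" "S \<subseteq> carrier A" "\<one>\<^bsub>A\<^esub> \<in> S" "\<And>s t. s \<in> S \<Longrightarrow> t \<in> S \<Longrightarrow> s \<otimes>\<^bsub>A\<^esub> t \<in> S"
  shows "S \<subseteq> \<Gamma>"
proof -
  interpret A: cring A by fact
  let ?gen = "generate (add_monoid A)"
  have sub: "subring \<Gamma> A" and span: "?gen {q \<odot>\<^bsub>A\<^esub> x | q x. x \<in> \<Gamma>} = carrier A"
    using max by (auto simp: maximal_Z_order_def Z_order_def)
  obtain T where T: "finite T" "T \<subseteq> carrier A" "\<Gamma> = ?gen T"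
    using max by (auto simp: maximal_Z_order_def Z_order_def)
  note \<Gamma> = subringE[OF sub]
  define P where "P = {c \<otimes>\<^bsub>A\<^esub> s | c s. c \<in> \<Gamma> \<and> s \<in> S}"
  define Q where "Q = {c \<otimes>\<^bsub>A\<^esub> s | c s. c \<in> T \<and> s \<in> S}"
  have P: "P \<subseteq> carrier A" and Q: "Q \<subseteq> carrier A"
    using \<Gamma>(1) S(2) T(2) by (auto simp: P_def Q_def)
  have \<Gamma>P: "\<Gamma> \<subseteq> P" and SP: "S \<subseteq> P"
  proof
    fix c assume "c \<in> \<Gamma>"
    then show "c \<in> P" using S(3) \<Gamma>(1) A.r_one[of c] unfolding P_def by force
  next
    show "S \<subseteq> P"
    proof
      fix s assume "s \<in> S"
      then show "s \<in> P" using S(2) \<Gamma>(3) A.l_one[of s] unfolding P_def by force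
    qed
  qed
  have incl: "x \<in> ?gen M" if "x \<in> M" for x M
    using that by (rule generate.incl)
  have PP: "x \<otimes>\<^bsub>A\<^esub> y \<in> P" if xy: "x \<in> P" "y \<in> P" for x y
  proof -
    obtain c s d t where x: "x = c \<otimes>\<^bsub>A\<^esub> s" "c \<in> \<Gamma>" "s \<in> S" and y: "y = d \<otimes>\<^bsub>A\<^esub> t" "d \<in> \<Gamma>" "t \<in> S"
      using xy unfolding P_def by blast
    have "x \<otimes>\<^bsub>A\<^esub> y = (c \<otimes>\<^bsub>A\<^esub> d) \<otimes>\<^bsub>A\<^esub> (s \<otimes>\<^bsub>A\<^esub> t)"
      using x y \<Gamma>(1) S(2) by (simp add: A.m_ac subset_iff)
    then show ?thesis unfolding P_def using \<Gamma>(6) S(4) x y by blast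
  qed
  have "?gen P = ?gen Q"
  proof
    have "P \<subseteq> ?gen Q"
    proof
      fix x assume "x \<in> P"
      then obtain c s where x: "x = c \<otimes>\<^bsub>A\<^esub> s" "c \<in> ?gen T" "s \<in> S"
        unfolding P_def T(3) by blast
      show "x \<in> ?gen Q"
        unfolding x(1)
        by (rule A.generate_mult_closed[OF T(2) _ S(2) Q x(2) incl[OF x(3)]])
           (rule incl, auto simp: Q_def)
    qed
    then show "?gen P \<subseteq> ?gen Q"
      by (rule A.add.generate_subgroup_incl) (rule A.add.generate_is_subgroup[OF Q])
    have "Q \<subseteq> P"
      unfolding P_def Q_def T(3) using incl by blast
    then show "?gen Q \<subseteq> ?gen P"
      using P by (intro A.add.mono_generate) auto
  qed
  moreover have "finite Q"
  proof -
    have "Q = (\<lambda>(c, s). c \<otimes>\<^bsub>A\<^esub> s) ` (T \<times> S)" by (auto simp: Q_def)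
    then show ?thesis using T(1) S(1) by simp
  qed
  ultimately have fg: "\<exists>M. finite M \<and> M \<subseteq> carrier A \<and> ?gen P = ?gen M"
    using Q by blast
  have PA: "?gen P \<subseteq> carrier A" by (rule A.add.generate_incl[OF P])
  have PG: "P \<subseteq> ?gen P" using incl by blast
  interpret N: additive_subgroup "?gen P" A
    by (intro additive_subgroup.intro A.add.generate_is_subgroup P)
  have "subring (?gen P) A"
  proof (rule A.subringI)
    show "\<one>\<^bsub>A\<^esub> \<in> ?gen P" using \<Gamma>P \<Gamma>(3) PG by blast
    show "x \<otimes>\<^bsub>A\<^esub> y \<in> ?gen P" if "x \<in> ?gen P" "y \<in> ?gen P" for x y
      by (rule A.generate_mult_closed[OF P _ P P that]) (use PP PG in blast)
  qed (use PA N.a_closed N.a_inv_closed in auto)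
  moreover have "?gen {q \<odot>\<^bsub>A\<^esub> x | q x. x \<in> ?gen P} = carrier A"
  proof
    have *: "{q \<odot>\<^bsub>A\<^esub> x | q x. x \<in> ?gen P} \<subseteq> carrier A"
      using smult PA by blast
    show "?gen {q \<odot>\<^bsub>A\<^esub> x | q x. x \<in> ?gen P} \<subseteq> carrier A"
      by (rule A.add.generate_incl[OF *])
    have "{q \<odot>\<^bsub>A\<^esub> x | q x. x \<in> \<Gamma>} \<subseteq> {q \<odot>\<^bsub>A\<^esub> x | q x. x \<in> ?gen P}"
      using subset_trans[OF \<Gamma>P PG] by (intro subsetI, elim CollectE exE conjE, intro CollectI exI conjI) auto
    then have "?gen {q \<odot>\<^bsub>A\<^esub> x | q x. x \<in> \<Gamma>} \<subseteq> ?gen {q \<odot>\<^bsub>A\<^esub> x | q x. x \<in> ?gen P}"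
      by (rule A.add.mono_generate)
    then show "carrier A \<subseteq> ?gen {q \<odot>\<^bsub>A\<^esub> x | q x. x \<in> ?gen P}"
      unfolding span .
  qed
  ultimately have "Z_order A (?gen P)"
    using fg unfolding Z_order_def by blast
  then have "?gen P = \<Gamma>"
    using max \<Gamma>P PG unfolding maximal_Z_order_def by blast
  then show ?thesis using SP PG by blast
qed

section \<open>The integral group ring inside a maximal order\<close>

text \<open>
  The choice \<open>SOME y. y \<in> {x, \<sigma> x}\<close> depends only on the orbit of \<open>x\<close>, so its fixed points form a transversal
  of the orbits.
\<close>

lemma fixed_point_free_involution_transversal:
  assumes fin: "finite A" and \<sigma>: "\<And>x. x \<in> A \<Longrightarrow> \<sigma> x \<in> A \<and> \<sigma> x \<noteq> x \<and> \<sigma> (\<sigma> x) = x"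
  obtains T where "T \<subseteq> A" "\<And>x. x \<in> A \<Longrightarrow> \<sigma> x \<in> T \<longleftrightarrow> x \<notin> T" "card A = 2 * card T"
proof
  define r where "r x = (SOME y. y \<in> {x, \<sigma> x})" for x
  let ?T = "{x \<in> A. r x = x}"
  have r: "r x \<in> {x, \<sigma> x}" for x
    unfolding r_def by (rule someI[of _ x]) simp
  have r\<sigma>: "r (\<sigma> x) = r x" if "x \<in> A" for x
    using \<sigma>[OF that] unfolding r_def by (metis (no_types, lifting) insert_commute)
  show "?T \<subseteq> A" by blast
  show T: "\<sigma> x \<in> ?T \<longleftrightarrow> x \<notin> ?T" if "x \<in> A" for x
    using r[of x] r\<sigma>[OF that] \<sigma>[OF that] that by auto
  have "A = ?T \<union> \<sigma> ` ?T"
  proof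
    show "A \<subseteq> ?T \<union> \<sigma> ` ?T"
    proof
      fix x assume x: "x \<in> A"
      show "x \<in> ?T \<union> \<sigma> ` ?T"
      proof (cases "x \<in> ?T")
        case False
        then have "\<sigma> x \<in> ?T" using T[OF x] by blast
        then show ?thesis
          using \<sigma>[OF x] by (intro UnI2 image_eqI[of x \<sigma> "\<sigma> x"]) simp_all
      qed blast
    qed
    show "?T \<union> \<sigma> ` ?T \<subseteq> A" using \<sigma> by auto
  qed
  moreover have "?T \<inter> \<sigma> ` ?T = {}"
    using T \<sigma> by auto
  moreover have "card (\<sigma> ` ?T) = card ?T"
    by (intro card_image inj_on_inverseI[where g = \<sigma>]) (use \<sigma> in auto)
  ultimately show "card A = 2 * card ?T"
    using fin card_Un_disjoint[of ?T "\<sigma> ` ?T"] by simp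
qed

locale finite_abelian_group = G: comm_group G for G :: "('g, 'm) monoid_scheme" +
  assumes finite_carrier: "finite (carrier G)"
begin

sublocale Q: finite_group_ring rat_field G
  by (intro finite_group_ring.intro finite_group_ring_axioms.intro cring_rat_field G.comm_group_axioms finite_carrier)

sublocale Z: finite_group_ring int_subring G
  by (intro finite_group_ring.intro finite_group_ring_axioms.intro cring_int_subring G.comm_group_axioms finite_carrier)

abbreviation "QG \<equiv> group_ring rat_field G"
abbreviation "ZG \<equiv> group_ring int_subring G"
abbreviation N where "N \<equiv> group_sum int_subring G"
abbreviation \<delta> where "\<delta> \<equiv> group_ring_of rat_field G"

lemma ZG_subset_QG: "f \<in> carrier ZG \<Longrightarrow> f \<in> carrier QG"
  by (auto simp: Q.carrier_group_ring Z.carrier_group_ring)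

lemma add_ZG: "f \<oplus>\<^bsub>ZG\<^esub> h = f \<oplus>\<^bsub>QG\<^esub> h"
  by (simp add: Q.add_group_ring Z.add_group_ring)

lemma mult_ZG:
  assumes "f \<in> carrier ZG" "h \<in> carrier ZG"
  shows "f \<otimes>\<^bsub>ZG\<^esub> h = f \<otimes>\<^bsub>QG\<^esub> h"
  unfolding Q.mult_group_ring Z.mult_group_ring
  using Z.group_ring_closed[OF assms(1)] Z.group_ring_closed[OF assms(2)] finite_carrier
  by (intro restrict_ext) (simp add: finsum_rat_field finsum_int_subring)

lemma add_pow_ZG_apply: "\<lbrakk>f \<in> carrier ZG; g \<in> carrier G\<rbrakk> \<Longrightarrow> add_pow ZG (n::nat) f g = of_nat n * f g"
  by (simp add: Z.add_pow_group_ring_apply add_pow_int_subring)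

lemma add_pow_QG_apply: "\<lbrakk>f \<in> carrier QG; g \<in> carrier G\<rbrakk> \<Longrightarrow> add_pow QG (n::nat) f g = of_nat n * f g"
  by (simp add: Q.add_pow_group_ring_apply add_pow_rat_field)

lemma mult_N:
  assumes "f \<in> carrier ZG" "g \<in> carrier G"
  shows "(f \<otimes>\<^bsub>ZG\<^esub> N) g = (\<Sum>x\<in>carrier G. f x)"
  using assms Z.group_ring_closed[OF assms(1)] finite_carrier
  by (simp add: Z.mult_group_sum finsum_int_subring)

lemma N_apply: "g \<in> carrier G \<Longrightarrow> N g = 1"
  by (simp add: Z.group_sum_apply)

lemma mult_N_eq_multiple:
  assumes "f \<in> carrier ZG" "(\<Sum>x\<in>carrier G. f x) = of_nat n"
  shows "f \<otimes>\<^bsub>ZG\<^esub> N = add_pow ZG n N"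
  using assms Z.group_sum_closed
  by (intro Z.group_ring_eqI) (auto simp: mult_N add_pow_ZG_apply N_apply)

text \<open>
  The sum of the coefficients may be negative; adding a multiple of \<open>p\<close> turns it into a natural number, and the
  correction is a multiple of \<open>pN\<close>, which will vanish in the quotient.
\<close>

lemma mult_N_mod:
  assumes f: "f \<in> carrier ZG" and p: "(p::nat) > 0"
  obtains n k :: nat where "add_pow ZG n N = f \<otimes>\<^bsub>ZG\<^esub> N \<oplus>\<^bsub>ZG\<^esub> add_pow ZG k (add_pow ZG p N)"
proof -
  have "(\<Sum>x\<in>carrier G. f x) \<in> \<int>"
    using Z.group_ring_closed[OF f] by (intro Ints_sum) auto
  then obtain c :: int where c: "(\<Sum>x\<in>carrier G. f x) = of_int c"
    by (auto elim: Ints_cases)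
  define k where "k = nat \<bar>c\<bar>"
  define n where "n = nat (c + int k * int p)"
  have "\<bar>c\<bar> * 1 \<le> \<bar>c\<bar> * int p"
    using p by (intro mult_left_mono) auto
  then have "c + int k * int p \<ge> 0"
    using abs_ge_minus_self[of c] by (simp add: k_def)
  then have "int n = c + int k * int p"
    by (simp add: n_def)
  then have n: "(of_nat n :: rat) = of_int c + of_nat k * of_nat p"
    by (metis of_int_add of_int_mult of_int_of_nat_eq)
  have "add_pow ZG n N = f \<otimes>\<^bsub>ZG\<^esub> N \<oplus>\<^bsub>ZG\<^esub> add_pow ZG k (add_pow ZG p N)"
  proof (rule Z.group_ring_eqI)
    fix g assume "g \<in> carrier G"
    then show "add_pow ZG n N g = (f \<otimes>\<^bsub>ZG\<^esub> N \<oplus>\<^bsub>ZG\<^esub> add_pow ZG k (add_pow ZG p N)) g"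
      using f Z.group_sum_closed
      by (simp add: Z.add_group_ring mult_N add_pow_ZG_apply N_apply c n)
  qed (use f Z.group_sum_closed in auto)
  then show ?thesis by (rule that)
qed

text \<open>
  With \<open>s\<close> of order two and \<open>T\<close> a transversal of \<open>{1, s}\<close>, the factors are \<open>1 + s\<close> and \<open>\<Sum>T\<close>. Their
  augmentations are \<open>2\<close> and \<open>|G|/2\<close>, both even.
\<close>

lemma N_factorisation:
  assumes four: "4 dvd Coset.order G"
  obtains u v m where "u \<in> carrier ZG" "v \<in> carrier ZG" "N = u \<otimes>\<^bsub>ZG\<^esub> v"
    "u \<otimes>\<^bsub>ZG\<^esub> N = add_pow ZG (2::nat) N" "v \<otimes>\<^bsub>ZG\<^esub> N = add_pow ZG (2 * m :: nat) N"
proof -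
  obtain l where l: "Coset.order G = 2 ^ 1 * (2 * l)"
    using four by (auto elim!: dvdE)
  obtain H where H: "subgroup H G" "card H = 2"
    using sylow_thm[OF two_is_prime_nat G.is_group l finite_carrier] by auto
  interpret H: subgroup H G by fact
  obtain s where s: "s \<in> H" "s \<noteq> \<one>\<^bsub>G\<^esub>" "H = {\<one>\<^bsub>G\<^esub>, s}"
  proof -
    obtain x y where "H = {x, y}" "x \<noteq> y"
      using H(2) by (meson card_2_iff)
    with H.one_closed show ?thesis using that[of x] that[of y] by auto
  qed
  have sG: "s \<in> carrier G" using s(1) H.subset by blast
  have ss: "s \<otimes>\<^bsub>G\<^esub> s = \<one>\<^bsub>G\<^esub>"
  proof -
    have "s \<otimes>\<^bsub>G\<^esub> s \<noteq> s" using sG s(2) by (metis G.r_cancel_one)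
    then show ?thesis using H.m_closed[OF s(1) s(1)] s(3) by auto
  qed
  have invs: "inv\<^bsub>G\<^esub> s = s" using ss sG by (metis G.inv_equality)
  have \<sigma>: "s \<otimes>\<^bsub>G\<^esub> x \<in> carrier G \<and> s \<otimes>\<^bsub>G\<^esub> x \<noteq> x \<and> s \<otimes>\<^bsub>G\<^esub> (s \<otimes>\<^bsub>G\<^esub> x) = x" if "x \<in> carrier G" for x
    using that sG s(2) ss by (metis G.l_one G.m_assoc G.m_closed G.r_cancel_one G.m_comm)
  obtain T where T: "T \<subseteq> carrier G" "\<And>x. x \<in> carrier G \<Longrightarrow> s \<otimes>\<^bsub>G\<^esub> x \<in> T \<longleftrightarrow> x \<notin> T"
      "card (carrier G) = 2 * card T"
    using fixed_point_free_involution_transversal[OF finite_carrier \<sigma>] by blast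
  let ?d = "group_ring_of int_subring G"
  let ?u = "?d \<one>\<^bsub>G\<^esub> \<oplus>\<^bsub>ZG\<^esub> ?d s"
  let ?v = "(\<lambda>x\<in>carrier G. if x \<in> T then 1 else 0) :: 'g \<Rightarrow> rat"
  have u: "?u \<in> carrier ZG" by (simp add: Z.group_ring_of_closed)
  have v: "?v \<in> carrier ZG" by (auto simp: Z.carrier_group_ring)
  have "N = ?u \<otimes>\<^bsub>ZG\<^esub> ?v"
  proof (rule Z.group_ring_eqI)
    fix x assume x: "x \<in> carrier G"
    have "?u \<otimes>\<^bsub>ZG\<^esub> ?v = ?d \<one>\<^bsub>G\<^esub> \<otimes>\<^bsub>ZG\<^esub> ?v \<oplus>\<^bsub>ZG\<^esub> ?d s \<otimes>\<^bsub>ZG\<^esub> ?v"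
      using v by (intro Z.RG.l_distr Z.group_ring_of_closed)
    then show "N x = (?u \<otimes>\<^bsub>ZG\<^esub> ?v) x"
      using x sG v T(2)[OF x] unfolding Z.add_group_ring
      by (simp add: Z.group_ring_of_mult invs N_apply)
  qed (use u v Z.group_sum_closed in auto)
  moreover have "?u \<otimes>\<^bsub>ZG\<^esub> N = add_pow ZG (2::nat) N"
  proof (rule mult_N_eq_multiple[OF u])
    have "(\<Sum>x\<in>carrier G. ?u x) = (\<Sum>x\<in>carrier G. (if x = \<one>\<^bsub>G\<^esub> then 1 else 0) + (if x = s then 1 else 0))"
      by (intro sum.cong) (auto simp: Z.add_group_ring group_ring_of_def)
    also have "\<dots> = 2"
      using sG finite_carrier by (simp add: sum.distrib sum.delta)
    finally show "(\<Sum>x\<in>carrier G. ?u x) = of_nat 2" by simp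
  qed
  moreover have "?v \<otimes>\<^bsub>ZG\<^esub> N = add_pow ZG (2 * l) N"
  proof (rule mult_N_eq_multiple[OF v])
    have "(\<Sum>x\<in>carrier G. ?v x) = (\<Sum>x\<in>carrier G. if x \<in> T then 1 else 0)"
      by (intro sum.cong) auto
    also have "\<dots> = of_nat (card T)"
      using T(1) finite_carrier by (simp add: sum.If_cases Int_absorb1)
    also have "card T = 2 * l"
      using T(3) l by (simp add: Coset.order_def)
    finally show "(\<Sum>x\<in>carrier G. ?v x) = of_nat (2 * l)" .
  qed
  ultimately show ?thesis using u v that by blast
qed

text \<open>
  The group elements together with the idempotent \<open>N/|G|\<close> form a finite multiplicative monoid:
  multiplying the idempotent by a group element does not change it.
\<close>

lemma maximal_order_contains:
  assumes max: "maximal_Z_order QG \<Gamma>"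
  shows ZG_subset_maximal_order: "carrier ZG \<subseteq> \<Gamma>"
    and idempotent_in_maximal_order: "(\<lambda>g\<in>carrier G. 1 / of_nat (Coset.order G)) \<in> \<Gamma>"
proof -
  let ?e = "(\<lambda>g\<in>carrier G. 1 / of_nat (Coset.order G)) :: 'g \<Rightarrow> rat"
  let ?S = "insert ?e (\<delta> ` carrier G)"
  have e: "?e \<in> carrier QG" by (simp add: Q.carrier_group_ring)
  have ord: "Coset.order G > 0"
    using finite_carrier G.one_closed unfolding Coset.order_def by (auto simp: card_gt_0_iff)
  have \<delta>e: "\<delta> g \<otimes>\<^bsub>QG\<^esub> ?e = ?e" if "g \<in> carrier G" for g
    unfolding Q.group_ring_of_mult[OF that e] using that by (intro restrict_ext) simp
  have ee: "?e \<otimes>\<^bsub>QG\<^esub> ?e = ?e"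
    unfolding Q.mult_group_ring using ord finite_carrier
    by (intro restrict_ext) (simp add: finsum_rat_field Coset.order_def)
  have S: "?S \<subseteq> \<Gamma>"
  proof (rule maximal_Z_order_contains_finite_submonoid[OF Q.cring_group_ring _ max])
    show "q \<odot>\<^bsub>QG\<^esub> x \<in> carrier QG" for q x
      by (simp add: group_ring_def)
    show "s \<otimes>\<^bsub>QG\<^esub> t \<in> ?S" if "s \<in> ?S" "t \<in> ?S" for s t
      using that \<delta>e ee Q.mult_group_ring_comm[OF Q.group_ring_of_closed e]
      by (auto simp: Q.group_ring_of_mult_group_ring_of)
  qed (use finite_carrier e in \<open>auto simp: Q.group_ring_of_closed Q.one_group_ring\<close>)
  show "?e \<in> \<Gamma>" using S by blast
  have "subring \<Gamma> QG"
    using max by (simp add: maximal_Z_order_def Z_order_def)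
  then have \<Gamma>: "subgroup \<Gamma> (add_monoid QG)"
    by (rule subring.axioms(1))
  show "carrier ZG \<subseteq> \<Gamma>"
  proof
    fix f assume f: "f \<in> carrier ZG"
    let ?F = "\<lambda>g. add_pow QG \<lfloor>f g\<rfloor> (\<delta> g)"
    have F: "?F g \<in> \<Gamma>" if "g \<in> carrier G" for g
      using Q.RG.add.subgroup_int_pow_closed[OF \<Gamma>, of "\<delta> g" "\<lfloor>f g\<rfloor>"] S that by auto
    have FQ: "?F \<in> carrier G \<rightarrow> carrier QG"
      using Q.RG.add.int_pow_closed Q.group_ring_of_closed by auto
    have f_sum: "f = (\<Oplus>\<^bsub>QG\<^esub>g\<in>carrier G. ?F g)"
    proof (rule Q.group_ring_eqI)
      fix x assume x: "x \<in> carrier G"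
      have "(\<Oplus>\<^bsub>QG\<^esub>g\<in>carrier G. ?F g) x = (\<Sum>g\<in>carrier G. if x = g then of_int \<lfloor>f g\<rfloor> else 0)"
        unfolding Q.finsum_group_ring_apply[OF finite_carrier FQ x] finsum_rat_field[OF finite_carrier]
        using x by (intro sum.cong refl)
          (simp add: Q.add_pow_group_ring_apply_int[OF Q.group_ring_of_closed x] add_pow_rat_field_int, simp add: group_ring_of_def)
      also have "\<dots> = of_int \<lfloor>f x\<rfloor>"
        using x finite_carrier by (simp add: sum.delta)
      also have "\<dots> = f x"
        using Z.group_ring_closed[OF f x] by (auto elim: Ints_cases)
      finally show "f x = (\<Oplus>\<^bsub>QG\<^esub>g\<in>carrier G. ?F g) x" ..
    qed (use f ZG_subset_QG Q.RG.finsum_closed[OF FQ] in auto)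
    have "(\<Oplus>\<^bsub>QG\<^esub>g\<in>A. ?F g) \<in> \<Gamma>" if "A \<subseteq> carrier G" for A
      using finite_subset[OF that finite_carrier] that
    proof (induction A rule: finite_induct)
      case empty
      then show ?case using subgroup.one_closed[OF \<Gamma>] by simp
    next
      case (insert a A)
      then show ?case
        using subgroup.m_closed[OF \<Gamma> F[of a]] FQ by (simp add: Pi_def subset_iff)
    qed
    from this[OF order_refl] show "f \<in> \<Gamma>"
      by (rule ssubst[OF f_sum, of "\<lambda>f. f \<in> \<Gamma>"])
  qed
qed

end

section \<open>The quotient by \<open>|G|\<Gamma> \<inter> p\<int>[G]\<close>\<close>

lemma (in ideal) Quot_representative:
  "Y \<in> carrier (R Quot I) \<Longrightarrow> \<exists>x\<in>carrier R. Y = I +> x"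
  by (auto simp: FactRing_def A_RCOSETS_def')

lemma (in ideal) Quot_coset_eq_zero: "x \<in> I \<Longrightarrow> I +> x = \<zero>\<^bsub>R Quot I\<^esub>"
  using a_rcos_zero[OF ideal_axioms] by (simp add: FactRing_def)

lemma (in ideal) ring_hom_factor_Quot:
  assumes "ring S" and \<phi>: "\<phi> \<in> ring_hom R S" and ker: "\<And>x. x \<in> I \<Longrightarrow> \<phi> x = \<zero>\<^bsub>S\<^esub>"
  obtains h where "h \<in> ring_hom (R Quot I) S" "\<And>x. x \<in> carrier R \<Longrightarrow> h (I +> x) = \<phi> x"
proof
  interpret S: ring S by fact
  let ?h = "\<lambda>Y. \<phi> (SOME x. x \<in> carrier R \<and> Y = I +> x)"
  have h: "?h (I +> x) = \<phi> x" if x: "x \<in> carrier R" for x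
  proof -
    let ?y = "SOME y. y \<in> carrier R \<and> I +> x = I +> y"
    have y: "?y \<in> carrier R" "I +> x = I +> ?y"
      using someI[of "\<lambda>y. y \<in> carrier R \<and> I +> x = I +> y" x] x by blast+
    then have d: "x \<ominus> ?y \<in> I"
      using quotient_eq_iff_same_a_r_cos[OF ideal_axioms x y(1)] by blast
    have "x = (x \<ominus> ?y) \<oplus> ?y"
      using x y(1) by (simp add: a_minus_def a_assoc l_neg)
    then have "\<phi> x = \<phi> (x \<ominus> ?y) \<oplus>\<^bsub>S\<^esub> \<phi> ?y"
      using ring_hom_add[OF \<phi>, of "x \<ominus> ?y" ?y] x y(1) by simp
    then show ?thesis
      using ker[OF d] ring_hom_closed[OF \<phi> y(1)] by simp
  qed
  show "?h (I +> x) = \<phi> x" if "x \<in> carrier R" for x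
    by (rule h[OF that])
  note rep = Quot_representative
  interpret \<pi>: ring_hom_ring R "R Quot I" "(+>) I"
    by (rule rcos_ring_hom_ring)
  show "?h \<in> ring_hom (R Quot I) S"
  proof (rule ring_hom_memI)
    fix Y Z assume "Y \<in> carrier (R Quot I)" "Z \<in> carrier (R Quot I)"
    then obtain x y where x: "x \<in> carrier R" "Y = I +> x" and y: "y \<in> carrier R" "Z = I +> y"
      using rep by meson
    show "?h Y \<in> carrier S"
      unfolding x(2) h[OF x(1)] by (rule ring_hom_closed[OF \<phi> x(1)])
    show "?h (Y \<otimes>\<^bsub>R Quot I\<^esub> Z) = ?h Y \<otimes>\<^bsub>S\<^esub> ?h Z"
      unfolding x(2) y(2) \<pi>.hom_mult[OF x(1) y(1), symmetric] h[OF x(1)] h[OF y(1)]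
        h[OF m_closed[OF x(1) y(1)]]
      by (rule ring_hom_mult[OF \<phi> x(1) y(1)])
    show "?h (Y \<oplus>\<^bsub>R Quot I\<^esub> Z) = ?h Y \<oplus>\<^bsub>S\<^esub> ?h Z"
      unfolding x(2) y(2) \<pi>.hom_add[OF x(1) y(1), symmetric] h[OF x(1)] h[OF y(1)]
        h[OF a_closed[OF x(1) y(1)]]
      by (rule ring_hom_add[OF \<phi> x(1) y(1)])
  next
    show "?h \<one>\<^bsub>R Quot I\<^esub> = \<one>\<^bsub>S\<^esub>"
      unfolding \<pi>.hom_one[symmetric] h[OF one_closed] by (rule ring_hom_one[OF \<phi>])
  qed
qed

context finite_abelian_group
begin

context
  fixes \<Gamma> I :: "('g \<Rightarrow> rat) set" and p :: nat
  assumes max: "maximal_Z_order QG \<Gamma>"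
    and I_def: "I = (\<lambda>x. add_pow QG (Coset.order G) x) ` \<Gamma> \<inter> (\<lambda>x. add_pow ZG p x) ` carrier ZG"
begin

text \<open>
  Closure of \<open>|G|\<Gamma>\<close> under multiplication by \<open>\<int>[G]\<close> follows from the inclusion \<open>\<int>[G] \<subseteq> \<Gamma>\<close>.
  Closure under negation is multiplication by \<open>-1\<close>.
\<close>

lemma scaled_order_ideal: "ideal I ZG"
proof -
  have sub: "subring \<Gamma> QG"
    using max by (simp add: maximal_Z_order_def Z_order_def)
  note \<Gamma> = subringE[OF sub]
  let ?n = "Coset.order G"
  have I_elem: "x \<in> I \<longleftrightarrow> (\<exists>c\<in>\<Gamma>. x = add_pow QG ?n c) \<and> (\<exists>y\<in>carrier ZG. x = add_pow ZG p y)" for x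
    by (auto simp: I_def)
  have IZ: "I \<subseteq> carrier ZG"
    by (auto simp: I_def)
  have mult: "f \<otimes>\<^bsub>ZG\<^esub> x \<in> I" if f: "f \<in> carrier ZG" and x: "x \<in> I" for f x
  proof -
    obtain c y where c: "c \<in> \<Gamma>" "x = add_pow QG ?n c" and y: "y \<in> carrier ZG" "x = add_pow ZG p y"
      using x unfolding I_elem by blast
    have fQ: "f \<in> carrier QG" and cQ: "c \<in> carrier QG" and f\<Gamma>: "f \<in> \<Gamma>"
      using f c(1) \<Gamma>(1) ZG_subset_QG ZG_subset_maximal_order[OF max] by auto
    have "f \<otimes>\<^bsub>ZG\<^esub> x = f \<otimes>\<^bsub>QG\<^esub> x"
      using f x IZ by (intro mult_ZG) auto
    also have "\<dots> = add_pow QG ?n (f \<otimes>\<^bsub>QG\<^esub> c)"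
      unfolding c(2) by (rule Q.RG.add_pow_rdistr[OF fQ cQ])
    finally have "\<exists>c\<in>\<Gamma>. f \<otimes>\<^bsub>ZG\<^esub> x = add_pow QG ?n c"
      using \<Gamma>(6)[OF f\<Gamma> c(1)] by blast
    moreover have "f \<otimes>\<^bsub>ZG\<^esub> x = add_pow ZG p (f \<otimes>\<^bsub>ZG\<^esub> y)"
      unfolding y(2) by (rule Z.RG.add_pow_rdistr[OF f y(1)])
    ultimately show ?thesis
      unfolding I_elem using f y(1) by blast
  qed
  have add: "x \<oplus>\<^bsub>ZG\<^esub> x' \<in> I" if x: "x \<in> I" and x': "x' \<in> I" for x x'
  proof -
    obtain c y where c: "c \<in> \<Gamma>" "x = add_pow QG ?n c" and y: "y \<in> carrier ZG" "x = add_pow ZG p y"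
      using x unfolding I_elem by blast
    obtain c' y' where c': "c' \<in> \<Gamma>" "x' = add_pow QG ?n c'" and y': "y' \<in> carrier ZG" "x' = add_pow ZG p y'"
      using x' unfolding I_elem by blast
    have cQ: "c \<in> carrier QG" "c' \<in> carrier QG"
      using c(1) c'(1) \<Gamma>(1) by auto
    have "x \<oplus>\<^bsub>ZG\<^esub> x' = add_pow QG ?n (c \<oplus>\<^bsub>QG\<^esub> c')"
      unfolding add_ZG c(2) c'(2) by (rule Q.RG.add.nat_pow_distrib[OF cQ, symmetric])
    moreover have "x \<oplus>\<^bsub>ZG\<^esub> x' = add_pow ZG p (y \<oplus>\<^bsub>ZG\<^esub> y')"
      unfolding y(2) y'(2) by (rule Z.RG.add.nat_pow_distrib[OF y(1) y'(1), symmetric])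
    ultimately show ?thesis
      unfolding I_elem using \<Gamma>(7)[OF c(1) c'(1)] y(1) y'(1) by blast
  qed
  have zero: "\<zero>\<^bsub>ZG\<^esub> \<in> I"
  proof -
    have "\<zero>\<^bsub>ZG\<^esub> = add_pow QG ?n \<zero>\<^bsub>QG\<^esub>" "\<zero>\<^bsub>ZG\<^esub> = add_pow ZG p \<zero>\<^bsub>ZG\<^esub>"
      using Q.RG.add.nat_pow_one[of ?n] Z.RG.add.nat_pow_one[of p]
      by (simp_all add: Q.zero_group_ring Z.zero_group_ring)
    then show ?thesis unfolding I_elem using \<Gamma>(2) Z.RG.zero_closed by blast
  qed
  show ?thesis
  proof (rule idealI)
    show "subgroup I (add_monoid ZG)"
    proof (rule Z.RG.add.subgroupI)
      fix x assume x: "x \<in> I"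
      then have xZ: "x \<in> carrier ZG" using IZ by blast
      have "\<ominus>\<^bsub>ZG\<^esub> x = (\<ominus>\<^bsub>ZG\<^esub> \<one>\<^bsub>ZG\<^esub>) \<otimes>\<^bsub>ZG\<^esub> x"
        using xZ Z.RG.l_minus[OF Z.RG.one_closed xZ] by simp
      then show "\<ominus>\<^bsub>ZG\<^esub> x \<in> I"
        using mult[OF _ x, of "\<ominus>\<^bsub>ZG\<^esub> \<one>\<^bsub>ZG\<^esub>"] by simp
    qed (use IZ zero add in auto)
    show "x \<otimes>\<^bsub>ZG\<^esub> a \<in> I" if "a \<in> I" "x \<in> carrier ZG" for a x
      using mult that by blast
    show "a \<otimes>\<^bsub>ZG\<^esub> x \<in> I" if "a \<in> I" "x \<in> carrier ZG" for a x
      using mult[OF that(2,1)] that IZ Z.RG.m_comm[of a x] by auto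
  qed (rule Z.RG.ring_axioms)
qed

text \<open>
  The identity \<open>pN = |G| (p N/|G|)\<close> places \<open>pN\<close> in \<open>|G|\<Gamma>\<close>.
\<close>

lemma p_multiple_of_N_in_ideal: "add_pow ZG p N \<in> I"
proof -
  let ?n = "Coset.order G"
  let ?e = "(\<lambda>g\<in>carrier G. 1 / of_nat ?n) :: 'g \<Rightarrow> rat"
  have sub: "subring \<Gamma> QG"
    using max by (simp add: maximal_Z_order_def Z_order_def)
  have e: "?e \<in> \<Gamma>" by (rule idempotent_in_maximal_order[OF max])
  have eQ: "?e \<in> carrier QG" using e subringE(1)[OF sub] by blast
  have n: "?n > 0"
    using finite_carrier G.one_closed unfolding Coset.order_def by (auto simp: card_gt_0_iff)
  have "add_pow QG k x \<in> \<Gamma>" if "x \<in> \<Gamma>" for k :: nat and x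
    using that subringE(2,7)[OF sub] by (induction k) (simp_all add: add_pow_def nat_pow_def)
  from this[OF e] have "add_pow QG p ?e \<in> \<Gamma>" .
  moreover have "add_pow ZG p N = add_pow QG ?n (add_pow QG p ?e)"
  proof (rule Q.group_ring_eqI)
    fix g assume g: "g \<in> carrier G"
    then show "add_pow ZG p N g = add_pow QG ?n (add_pow QG p ?e) g"
      using n eQ Z.group_sum_closed
      by (simp add: add_pow_ZG_apply add_pow_QG_apply N_apply)
  qed (use eQ Z.group_sum_closed ZG_subset_QG in auto)
  ultimately show ?thesis
    unfolding I_def using Z.group_sum_closed by blast
qed

text \<open>
  The divisibility by \<open>4\<close> is what makes both factors of \<open>N\<close> annihilate \<open>t\<close> modulo \<open>I\<close>; it fails for the
  group of order two.
\<close>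

theorem K2_rel_scaled_order_quotient:
  assumes p: "Factorial_Ring.prime p" and pG: "p dvd Coset.order G"
    and two: "p = 2 \<Longrightarrow> 4 dvd Coset.order G"
  defines "FG \<equiv> group_ring (residue_ring (int p)) G"
  shows "K2_rel (ZG Quot I) (Idl\<^bsub>ZG Quot I\<^esub> {I +>\<^bsub>ZG\<^esub> N})
       \<cong> K2_rel FG (Idl\<^bsub>FG\<^esub> {group_sum (residue_ring (int p)) G})"
proof -
  have p1: "1 < p" using p by (rule prime_gt_1_nat)
  interpret res: residues "int p" "residue_ring (int p)"
    using p1 by (intro residues.intro) simp_all
  interpret F: finite_group_ring "residue_ring (int p)" G
    by (intro finite_group_ring.intro finite_group_ring_axioms.intro res.cring G.comm_group_axioms finite_carrier)
  interpret I: ideal I ZG by (rule scaled_order_ideal)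
  let ?R = "ZG Quot I"
  interpret R: cring ?R by (rule I.quotient_is_cring[OF Z.cring_group_ring])
  interpret \<pi>: ring_hom_cring ZG ?R "(+>\<^bsub>ZG\<^esub>) I"
    by (rule I.rcos_ring_hom_cring[OF Z.cring_group_ring])
  let ?\<pi> = "(+>\<^bsub>ZG\<^esub>) I" and ?t = "I +>\<^bsub>ZG\<^esub> N"
  have NZ: "N \<in> carrier ZG" by (rule Z.group_sum_closed)
  note \<pi>I = I.Quot_coset_eq_zero
  note rep = I.Quot_representative
  have pt: "add_pow ?R p ?t = \<zero>\<^bsub>?R\<^esub>"
    using \<pi>.hom_add_pow[OF NZ, of p] \<pi>I[OF p_multiple_of_N_in_ideal] by simp
  have multt: "add_pow ?R n ?t = \<zero>\<^bsub>?R\<^esub>" if pn: "p dvd n" for n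
  proof -
    obtain k where "n = p * k" using pn ..
    then have "add_pow ?R n ?t = add_pow ?R k (add_pow ?R p ?t)"
      using R.add.nat_pow_pow[of ?t k p] NZ by (simp add: mult.commute)
    then show ?thesis using pt by simp
  qed
  have pi_mult: "?\<pi> f \<otimes>\<^bsub>?R\<^esub> ?t = add_pow ?R n ?t" if "f \<in> carrier ZG" "f \<otimes>\<^bsub>ZG\<^esub> N = add_pow ZG n N" for f and n :: nat
    using \<pi>.hom_mult[OF that(1) NZ] \<pi>.hom_add_pow[OF NZ, of n] that(2) by simp
  interpret L: scalar_line_prime ?R ?t p
  proof
    show "?t \<in> carrier ?R" using NZ by simp
    show "\<exists>n::nat. r \<otimes>\<^bsub>?R\<^esub> ?t = add_pow ?R n ?t" if r: "r \<in> carrier ?R" for r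
    proof -
      obtain f where f: "f \<in> carrier ZG" "r = ?\<pi> f" using rep[OF r] by blast
      obtain n k :: nat where nk: "add_pow ZG n N = f \<otimes>\<^bsub>ZG\<^esub> N \<oplus>\<^bsub>ZG\<^esub> add_pow ZG k (add_pow ZG p N)"
        using mult_N_mod[OF f(1), of p] p1 by auto
      have "add_pow ?R n ?t = ?\<pi> (add_pow ZG n N)"
        using \<pi>.hom_add_pow[OF NZ, of n] by simp
      also have "\<dots> = ?\<pi> f \<otimes>\<^bsub>?R\<^esub> ?t \<oplus>\<^bsub>?R\<^esub> add_pow ?R k (?\<pi> (add_pow ZG p N))"
        unfolding nk using f NZ by (simp add: \<pi>.hom_add_pow)
      also have "\<dots> = r \<otimes>\<^bsub>?R\<^esub> ?t"
        using \<pi>I[OF p_multiple_of_N_in_ideal] f NZ by simp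
      finally show ?thesis by metis
    qed
    have "N \<otimes>\<^bsub>ZG\<^esub> N = add_pow ZG (Coset.order G) N"
      by (rule mult_N_eq_multiple[OF NZ]) (simp add: N_apply Coset.order_def)
    from pi_mult[OF NZ this] show "?t \<otimes>\<^bsub>?R\<^esub> ?t = \<zero>\<^bsub>?R\<^esub>"
      using multt[OF pG] by simp
    show "add_pow ?R p ?t = \<zero>\<^bsub>?R\<^esub>" by (rule pt)
    show "Factorial_Ring.prime p" by (rule p)
    show "\<exists>u\<in>carrier ?R. \<exists>v\<in>carrier ?R. ?t = u \<otimes>\<^bsub>?R\<^esub> v \<and> u \<otimes>\<^bsub>?R\<^esub> ?t = \<zero>\<^bsub>?R\<^esub> \<and> v \<otimes>\<^bsub>?R\<^esub> ?t = \<zero>\<^bsub>?R\<^esub>"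
      if p2: "p = 2"
    proof -
      obtain u v m where u: "u \<in> carrier ZG" "u \<otimes>\<^bsub>ZG\<^esub> N = add_pow ZG (2::nat) N"
        and v: "v \<in> carrier ZG" "v \<otimes>\<^bsub>ZG\<^esub> N = add_pow ZG (2 * m :: nat) N"
        and uv: "N = u \<otimes>\<^bsub>ZG\<^esub> v"
        using N_factorisation[OF two[OF p2]] by metis
      have "?t = ?\<pi> u \<otimes>\<^bsub>?R\<^esub> ?\<pi> v"
        by (subst uv) (rule \<pi>.hom_mult[OF u(1) v(1)])
      moreover have "?\<pi> u \<otimes>\<^bsub>?R\<^esub> ?t = \<zero>\<^bsub>?R\<^esub>" "?\<pi> v \<otimes>\<^bsub>?R\<^esub> ?t = \<zero>\<^bsub>?R\<^esub>"
        unfolding pi_mult[OF u] pi_mult[OF v] by (simp_all add: multt p2)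
      moreover have "?\<pi> u \<in> carrier ?R" "?\<pi> v \<in> carrier ?R"
        using u(1) v(1) by simp_all
      ultimately show ?thesis by blast
    qed
  qed
  define \<phi> where "\<phi> = (\<lambda>f. \<lambda>g\<in>carrier G. \<lfloor>f g :: rat\<rfloor> mod int p)"
  have \<phi>: "\<phi> \<in> ring_hom ZG FG"
    unfolding \<phi>_def FG_def
    by (rule group_ring_map_hom[OF Z.finite_group_ring_axioms F.finite_group_ring_axioms floor_mod_ring_hom])
       (use p1 in simp)
  have \<phi>_zero: "\<exists>y\<in>carrier ZG. f = add_pow ZG p y" if f: "f \<in> carrier ZG" and z: "\<phi> f = \<zero>\<^bsub>FG\<^esub>" for f
  proof -
    let ?y = "(\<lambda>g\<in>carrier G. of_int (\<lfloor>f g\<rfloor> div int p)) :: 'g \<Rightarrow> rat"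
    have y: "?y \<in> carrier ZG" by (auto simp: Z.carrier_group_ring)
    have "f = add_pow ZG p ?y"
    proof (rule Z.group_ring_eqI)
      fix g assume g: "g \<in> carrier G"
      have "\<lfloor>f g\<rfloor> mod int p = 0"
        using fun_cong[OF z, of g] g
        by (simp add: \<phi>_def FG_def F.zero_group_ring) (simp add: residue_ring_def)
      then have "\<lfloor>f g\<rfloor> = int p * (\<lfloor>f g\<rfloor> div int p)"
        using mult_div_mod_eq[of "int p" "\<lfloor>f g\<rfloor>"] by simp
      then have "of_int \<lfloor>f g\<rfloor> = (of_nat p * of_int (\<lfloor>f g\<rfloor> div int p) :: rat)"
        by (metis of_int_mult of_int_of_nat_eq)
      moreover have "of_int \<lfloor>f g\<rfloor> = f g"
        using Z.group_ring_closed[OF f g] by (auto elim: Ints_cases)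
      ultimately show "f g = add_pow ZG p ?y g"
        using g by (simp add: add_pow_ZG_apply[OF y g])
    qed (use f y in auto)
    then show ?thesis using y by blast
  qed
  have \<phi>I: "\<phi> x = \<zero>\<^bsub>FG\<^esub>" if x: "x \<in> I" for x
  proof -
    obtain y where y: "y \<in> carrier ZG" "x = add_pow ZG p y"
      using x by (auto simp: I_def)
    have "\<lfloor>x g\<rfloor> mod int p = 0" if g: "g \<in> carrier G" for g
    proof -
      obtain c :: int where "y g = of_int c"
        using Z.group_ring_closed[OF y(1) g] by (auto elim: Ints_cases)
      then have "x g = of_int (int p * c)"
        using y g by (simp add: add_pow_ZG_apply)
      then show ?thesis by (simp only: floor_of_int) simp
    qed
    then show ?thesis
      unfolding \<phi>_def FG_def F.zero_group_ring
      by (intro restrict_ext) (simp add: residue_ring_def)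
  qed
  obtain h where h: "h \<in> ring_hom ?R FG" and h\<pi>: "\<And>x. x \<in> carrier ZG \<Longrightarrow> h (?\<pi> x) = \<phi> x"
    using I.ring_hom_factor_Quot[OF F.RG.ring_axioms[folded FG_def] \<phi> \<phi>I] by blast
  have \<phi>N: "\<phi> N = group_sum (residue_ring (int p)) G"
    unfolding F.group_sum_apply \<phi>_def using p1
    by (intro restrict_ext) (simp add: N_apply residue_ring_def)
  have "K2_rel ?R (Idl\<^bsub>?R\<^esub> {?t}) \<cong> K2_rel FG (Idl\<^bsub>FG\<^esub> {h ?t})"
  proof (rule L.K2_rel_iso_mod_p[OF F.cring_group_ring[folded FG_def] h])
    show "h ` carrier ?R = carrier FG"
    proof
      show "h ` carrier ?R \<subseteq> carrier FG" using ring_hom_closed[OF h] by blast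
      show "carrier FG \<subseteq> h ` carrier ?R"
      proof
        fix s assume s: "s \<in> carrier FG"
        let ?f = "(\<lambda>g\<in>carrier G. of_int (s g)) :: 'g \<Rightarrow> rat"
        have f: "?f \<in> carrier ZG" by (auto simp: Z.carrier_group_ring)
        have "\<phi> ?f = s"
        proof (rule F.group_ring_eqI)
          show "\<phi> ?f \<in> carrier (group_ring (residue_ring (int p)) G)"
            using ring_hom_closed[OF \<phi> f] by (simp add: FG_def)
          fix g assume g: "g \<in> carrier G"
          have "s g \<in> {0..int p - 1}"
            using F.group_ring_closed[of s g] s g by (simp add: FG_def residue_ring_def)
          then show "\<phi> ?f g = s g" using g by (simp add: \<phi>_def)
        qed (use s in \<open>simp add: FG_def\<close>)
        then show "s \<in> h ` carrier ?R"
          using h\<pi>[OF f] \<pi>.hom_closed[OF f] by (metis imageI)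
      qed
    qed
    show "\<exists>y\<in>carrier ?R. x = add_pow ?R p y" if x: "x \<in> carrier ?R" "h x = \<zero>\<^bsub>FG\<^esub>" for x
    proof -
      obtain f where f: "f \<in> carrier ZG" "x = ?\<pi> f" using rep[OF x(1)] by blast
      obtain y where y: "y \<in> carrier ZG" "f = add_pow ZG p y"
        using \<phi>_zero[OF f(1)] x(2) h\<pi>[OF f(1)] f(2) by auto
      have "x = add_pow ?R p (?\<pi> y)"
        unfolding f(2) y(2) by (rule \<pi>.hom_add_pow[OF y(1)])
      then show ?thesis using \<pi>.hom_closed[OF y(1)] by blast
    qed
    show "h ?t \<noteq> \<zero>\<^bsub>FG\<^esub>"
    proof
      assume "h ?t = \<zero>\<^bsub>FG\<^esub>"
      then have "\<phi> N \<one>\<^bsub>G\<^esub> = \<zero>\<^bsub>FG\<^esub> \<one>\<^bsub>G\<^esub>"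
        using h\<pi>[OF NZ] by simp
      then show False
        unfolding \<phi>N F.group_sum_apply FG_def F.zero_group_ring by (simp add: residue_ring_def)
    qed
  qed
  then show ?thesis unfolding h\<pi>[OF NZ] \<phi>N .
qed

end

end

theorem proposition3p3:
  fixes G :: "('g, 'm) monoid_scheme" and p :: nat
    and \<Gamma> J I :: "('g \<Rightarrow> rat) set"
  defines "QG \<equiv> group_ring rat_field G"
    and "ZG \<equiv> group_ring int_subring G"
    and "FG \<equiv> group_ring (residue_ring (int p)) G"
  assumes "Factorial_Ring.prime p"
    and "comm_group G" and "\<exists>n. Coset.order G = p ^ n" and "Coset.order G > 2"
    and "maximal_Z_order QG \<Gamma>"
    and "J = (\<lambda>x. add_pow QG (Coset.order G) x) ` \<Gamma>"
    and "I = J \<inter> (\<lambda>x. add_pow ZG p x) ` carrier ZG"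
  shows "K2_rel (ZG Quot I) (Idl\<^bsub>ZG Quot I\<^esub> {I +>\<^bsub>ZG\<^esub> group_sum int_subring G})
       \<cong> K2_rel FG (Idl\<^bsub>FG\<^esub> {group_sum (residue_ring (int p)) G})"
proof -
  interpret comm_group G by fact
  interpret finite_abelian_group G
  proof
    show "finite (carrier G)"
      using \<open>Coset.order G > 2\<close> card.infinite unfolding Coset.order_def by fastforce
  qed
  obtain n where n: "Coset.order G = p ^ n"
    using \<open>\<exists>n. Coset.order G = p ^ n\<close> by blast
  have n1: "1 \<le> n"
    using \<open>Coset.order G > 2\<close> n by (cases n) auto
  have pG: "p dvd Coset.order G"
    unfolding n using n1 by (intro dvd_power) auto
  have "4 dvd Coset.order G" if "p = 2"
  proof -
    have "2 \<le> n"
      using \<open>Coset.order G > 2\<close> n n1 that by (cases "n = 1") auto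
    then have "(2::nat) ^ 2 dvd 2 ^ n" by (rule le_imp_power_dvd)
    then show ?thesis unfolding n that by simp
  qed
  then show ?thesis
    using K2_rel_scaled_order_quotient[of \<Gamma> I p] assms pG by simp
qed

end
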